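(* The following two questions about Krein systems both have a negative answer. Explicitly: (Q1) It is not true that for every $A\in L^2(\mathbb{R}^+)$ the limits $\lim_{x\to\infty}\mathfrak{A}(x,\xi,A)$ and $\lim_{x\to\infty}\mathfrak{B}(x,\xi,A)$ both exist for a.e. $\xi\in\mathbb{R}$. That is, there is $A\in L^2(\mathbb{R}^+)$ such that the set of $\xi\in\mathbb{R}$ for which at least one of these two limits fails to exist is not a Lebesgue null set. (Q2) It is not true that for every $A\in L^2(\mathbb{R}^+)$ one has $\mathfrak{M}(\xi,A)<\infty$ for a.e. $\xi\in\mathbb{R}$, and it is not true that for every $A\in L^2(\mathbb{R}^+)$ one has $\mathfrak{M}_w(\xi,A)<\infty$ for a.e. $\xi\in\mathbb{R}$. Moreover, the weak-type bounds fail even for small norms: for every $\delta_0>0$ there is no constant $K<\infty$ such that $$|\{\xi\in\mathbb{R}:\mathfrak{M}(\xi,A)\ge\lambda\}|\le K\,\frac{\|A\|_2}{\lambda}\qquad\text{for all }\lambda>0\text{ and all }A\in L^2(\mathbb{R}^+)\text{ with }\|A\|_2\le\delta_0,$$ and for every $\delta_0>0$ there is no constant $K<\infty$ such that $$|\{\xi\in\mathbb{R}:\mathfrak{M}_w(\xi,A)\ge\lambda\}|\le K\,\frac{\|A\|_2}{\lambda}\qquad\text{for all }\lambda>0\text{ and all }A\in L^2(\mathbb{R}^+)\text{ with }\|A\|_2\le\delta_0.$$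
   Context: $\mathbb{R}^+=[0,\infty)$, $\mathbb{C}^+=\{k\in\mathbb{C}:\operatorname{Im}k>0\}$, $|E|$ is Lebesgue measure of $E\subset\mathbb{R}$. For a complex-valued $A\in L^1_{\rm loc}(\mathbb{R}^+)$ and $k\in\mathbb{C}$, let $X(x,k,A)$ be the $2\times2$ fundamental matrix of the Krein system $$\partial_xX=\begin{pmatrix} ik&-\overline{A(x)}\\-A(x)&0\end{pmatrix}X,\qquad X(0,k,A)=\begin{pmatrix}1&0\\0&1\end{pmatrix},\qquad x\ge 0.$$ Define $\mathfrak{B}(x,k,A):=X_{21}(x,k,A)$ and $\mathfrak{A}(x,k,A):=X_{22}(x,k,A)$ (then $X=\begin{pmatrix}\mathfrak{A}^*&\mathfrak{B}^*\\ \mathfrak{B}&\mathfrak{A}\end{pmatrix}$ with $f^*(k):=e^{ikx}\overline{f(\bar k)}$). For each $x$, $\mathfrak{A}(x,\cdot,A)$ is entire, satisfies $|\mathfrak{A}|\ge1$ on $\overline{\mathbb{C}^+}$, tends to $1$ as $|k|\to\infty$ in $\overline{\mathbb{C}^+}$, and is outer in $\mathbb{C}^+$. Its argument is the imaginary part of the branch of $\log\mathfrak{A}$ that vanishes at infinity, i.e. $$\arg\mathfrak{A}(x,k,A)=\operatorname{Im}\Bigl(\frac1{\pi i}\int_{\mathbb{R}}\frac{\log|\mathfrak{A}(x,s,A)|}{s-k}\,ds\Bigr),\qquad k\in\mathbb{C}^+,$$ extended continuously to real $k$. For $\xi\in\mathbb{R}$ let $S_\xi=\{k\in\mathbb{C}^+:|\operatorname{Re}k-\xi|<\operatorname{Im}k\}$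 be the Stolz angle at $\xi$. The maximal functions are $$\mathfrak{M}(\xi,A)=\sup_{k\in S_\xi,\,x\in\mathbb{R}^+}|\arg\mathfrak{A}(x,k,A)|,\qquad \mathfrak{M}_w(\xi,A)=\sup_{x\in\mathbb{R}^+}|\arg\mathfrak{A}(x,\xi,A)|.$$ *)

theory Defs
  imports "HOL-Analysis.Analysis"
begin

definition L2_half_line :: "(real \<Rightarrow> complex) set" where
  "L2_half_line =
     {A. A \<in> borel_measurable (lebesgue_on {0..}) \<and>
         integrable (lebesgue_on {0..}) (\<lambda>x. (cmod (A x))\<^sup>2)}"

definition L2_half_line_norm :: "(real \<Rightarrow> complex) \<Rightarrow> real" where
  "L2_half_line_norm A = sqrt (LINT x|lebesgue_on {0..}. (cmod (A x))\<^sup>2)"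

definition krein_matrix :: "(real \<Rightarrow> complex) \<Rightarrow> complex \<Rightarrow> real \<Rightarrow> complex^2^2" where
  "krein_matrix A k x =
     vector [vector [\<i> * k, - cnj (A x)],
             vector [- A x,  0]]"

(* Since A is only locally integrable, the initial value problem is understood in the
   Caratheodory sense: the solution is locally absolutely continuous and satisfies the
   equation almost everywhere, i.e. it is a continuous solution of the integral equation. *)
definition krein_solution ::
    "(real \<Rightarrow> complex) \<Rightarrow> complex \<Rightarrow> (real \<Rightarrow> complex^2^2) \<Rightarrow> bool" where
  "krein_solution A k Y \<longleftrightarrow>
     continuous_on {0..} Y \<and>
     (\<forall>x\<ge>0. Y x = mat 1 + (LINT t:{0..x}|lebesgue. krein_matrix A k t ** Y t))"

(* For locally integrable A a solution exists and is unique on {0..}, so the value below does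
   not depend on the choice when 0 \<le> x; values at x < 0 are never used. *)
definition krein_X :: "real \<Rightarrow> complex \<Rightarrow> (real \<Rightarrow> complex) \<Rightarrow> complex^2^2" where
  "krein_X x k A = (SOME Y. krein_solution A k Y) x"

definition krein_B :: "real \<Rightarrow> complex \<Rightarrow> (real \<Rightarrow> complex) \<Rightarrow> complex" where
  "krein_B x k A = krein_X x k A $ 2 $ 1"

definition krein_A :: "real \<Rightarrow> complex \<Rightarrow> (real \<Rightarrow> complex) \<Rightarrow> complex" where
  "krein_A x k A = krein_X x k A $ 2 $ 2"

(* The branch of the argument of krein_A x _ A on the open upper half-plane that vanishes at
   infinity, given by the Schwarz integral of log |krein_A x _ A| over the real line. *)
definition arg_krein_A_upper :: "real \<Rightarrow> complex \<Rightarrow> (real \<Rightarrow> complex) \<Rightarrow> real" where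
  "arg_krein_A_upper x k A =
     Im (1 / (of_real pi * \<i>) *
         (LINT s|lebesgue. of_real (ln (cmod (krein_A x (of_real s) A))) / (of_real s - k)))"

(* On the real line: the continuous extension of the values in the upper half-plane. The value
   for Im k < 0 is never used. *)
definition arg_krein_A :: "real \<Rightarrow> complex \<Rightarrow> (real \<Rightarrow> complex) \<Rightarrow> real" where
  "arg_krein_A x k A =
     (if Im k > 0 then arg_krein_A_upper x k A
      else Lim (at k within {z. Im z > 0}) (\<lambda>z. arg_krein_A_upper x z A))"

definition stolz_angle :: "real \<Rightarrow> complex set" where
  "stolz_angle \<xi> = {k. Im k > 0 \<and> \<bar>Re k - \<xi>\<bar> < Im k}"

definition krein_maximal :: "real \<Rightarrow> (real \<Rightarrow> complex) \<Rightarrow> ereal" where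
  "krein_maximal \<xi> A = (SUP (k, x) \<in> stolz_angle \<xi> \<times> {0..}. ereal \<bar>arg_krein_A x k A\<bar>)"

definition krein_maximal_w :: "real \<Rightarrow> (real \<Rightarrow> complex) \<Rightarrow> ereal" where
  "krein_maximal_w \<xi> A = (SUP x \<in> {0..}. ereal \<bar>arg_krein_A x (of_real \<xi>) A\<bar>)"

(* M is a maximal operator, sending a point \<xi> and a coefficient A to M \<xi> A. *)
definition weak_type_bound ::
    "(real \<Rightarrow> (real \<Rightarrow> complex) \<Rightarrow> ereal) \<Rightarrow> real \<Rightarrow> real \<Rightarrow> bool" where
  "weak_type_bound M \<delta> K \<longleftrightarrow>
     (\<forall>A \<in> L2_half_line. L2_half_line_norm A \<le> \<delta> \<longrightarrow>
        (\<forall>t>0. emeasure lebesgue {\<xi>. M \<xi> A \<ge> ereal t}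
                 \<le> ennreal (K * L2_half_line_norm A / t)))"

end

theory Submission
  imports Defs "HOL-Complex_Analysis.Complex_Analysis" "HOL-Real_Asymp.Real_Asymp"
begin

text \<open>
  Let \<open>u = X\<^sub>1\<^sub>2\<close>, \<open>v = X\<^sub>2\<^sub>2\<close> and \<open>r = u / v\<close>. Then \<open>\<bar>r\<bar> \<le> 1\<close> in the closed upper half-plane and
  \<open>v = exp (- \<integral> A r)\<close>, so the argument is \<open>- \<integral> Im (A r)\<close>; the Schwarz formula identifies it with the
  branch in the statement. For a chirp \<open>A = c exp (- i \<phi>)\<close> put \<open>w = exp (- i \<phi>) r\<close>, so that
  \<open>w' = i (\<xi> - \<phi>') w - c (1 - w\<^sup>2)\<close>. While the instantaneous frequency \<open>\<phi>'\<close> approaches \<open>\<xi>\<close> from below,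
  \<open>w\<close> is close to \<open>- i c / (\<xi> - \<phi>')\<close>, so the argument grows like \<open>\<integral> c\<^sup>2 / (\<xi> - \<phi>')\<close>, which over one sweep
  of \<open>\<phi>'\<close> is \<open>c\<^sup>2 / \<phi>''\<close> times the logarithm of \<open>1 / c\<close>. Sweeping \<open>[0, 3]\<close> infinitely often, ever more slowly,
  keeps \<open>c\<close> square integrable while these increments tend to infinity, for every \<open>\<xi>\<close> in \<open>[1, 2]\<close>.
  An unbounded argument excludes convergence of \<open>v\<close> because \<open>\<bar>v\<bar> \<ge> 1\<close>.
\<close>

section \<open>Solutions of the Krein system\<close>

text \<open>The construction is governed by a budget. The integral of \<open>c^2\<close> over one
  sweep is that of \<open>c^2 / \<phi>''\<close> over the swept frequencies, so square integrability
  in effect makes this factor summable over the sweeps, and the phase gains can diverge only through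
  \<open>ln (1 / c)\<close>. Hence the amplitude must decay doubly exponentially in the number of
  the sweep, while the factor decays only exponentially. The obstacle is the resonance itself: at a
  distance comparable to \<open>c\<close> the approximation of \<open>w\<close> breaks down, and
  after the crossing nothing is known about \<open>r\<close>. Each sweep is therefore followed only
  up to distance \<open>8 * c\<close>, with \<open>c\<close> taken at its beginning, and the system
  is restarted with zero reflection coefficient at the beginning of the next one. The crossing and
  the downward half of each oscillation get no estimate: phase differences between two times of the
  same sweep that grow with the sweep already make the phase unbounded. Shrinking the amplitude by a
  constant changes neither mechanism, which is why the weak-type bounds fail for arbitrarily small
  norms as well.\<close>

lemma suminf_integral_M_test:
  fixes f :: "nat \<Rightarrow> real \<Rightarrow> complex"
  assumes cont: "\<And>n. continuous_on {a..b} (f n)"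
    and bound: "\<And>n x. x \<in> {a..b} \<Longrightarrow> norm (f n x) \<le> M n" and M: "summable M"
  shows "continuous_on {a..b} (\<lambda>x. \<Sum>n. f n x)"
    and "(\<lambda>n. integral {a..b} (f n)) sums integral {a..b} (\<lambda>x. \<Sum>n. f n x)"
proof -
  have ul: "uniform_limit {a..b} (\<lambda>n x. \<Sum>i<n. f i x) (\<lambda>x. \<Sum>i. f i x) sequentially"
    using bound M by (intro Weierstrass_m_test) auto
  have cs: "continuous_on {a..b} (\<lambda>x. \<Sum>i<n. f i x)" for n
    using cont by (intro continuous_intros) auto
  show "continuous_on {a..b} (\<lambda>x. \<Sum>n. f n x)"
    using ul cs by (intro uniform_limit_theorem[OF _ ul]) auto
  obtain I J where I: "\<And>n. ((\<lambda>x. \<Sum>i<n. f i x) has_integral I n) {a..b}"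
    and J: "((\<lambda>x. \<Sum>n. f n x) has_integral J) {a..b}" and lim: "I \<longlonglongrightarrow> J"
    using uniform_limit_integral[OF ul cs] by auto
  have "I n = (\<Sum>i<n. integral {a..b} (f i))" for n
  proof -
    have "I n = integral {a..b} (\<lambda>x. \<Sum>i<n. f i x)"
      using I[of n] by (simp add: integral_unique)
    also have "\<dots> = (\<Sum>i<n. integral {a..b} (f i))"
      using cont by (intro integral_sum) (auto intro: integrable_continuous_real)
    finally show ?thesis .
  qed
  then show "(\<lambda>n. integral {a..b} (f n)) sums integral {a..b} (\<lambda>x. \<Sum>n. f n x)"
    using lim unfolding integral_unique[OF J] sums_def by presburger
qed

lemma norm_integral_le:
  fixes f :: "real \<Rightarrow> 'a::euclidean_space"
  assumes "continuous_on {a..b} f"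
  shows "norm (integral {a..b} f) \<le> integral {a..b} (\<lambda>t. norm (f t))"
  by (rule integral_norm_bound_integral)
     (auto intro!: integrable_continuous_real continuous_on_norm assms)

section \<open>Polynomial dependence on the spectral parameter\<close>

text \<open>Every term of the Picard series is a polynomial in \<open>k\<close> with coefficients
  continuous in \<open>x\<close>. This class is closed under all operations of the recursion,
  including integration in \<open>x\<close>, and yields continuity in \<open>x\<close> and
  holomorphy in \<open>k\<close> together, so that nothing has to be differentiated under an
  integral sign.\<close>

definition poly_param :: "(complex \<Rightarrow> real \<Rightarrow> complex) \<Rightarrow> bool" where
  "poly_param f \<longleftrightarrow> (\<exists>N a. (\<forall>j. continuous_on {0..} (a j)) \<and>
     (\<forall>k. \<forall>x\<ge>0. f k x = (\<Sum>j<N. k ^ j * a j x)))"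

lemma poly_paramI:
  assumes "\<And>j. continuous_on {0..} (a j)" "\<And>k x. x \<ge> 0 \<Longrightarrow> f k x = (\<Sum>j<N. k ^ j * a j x)"
  shows "poly_param f"
  using assms unfolding poly_param_def by blast

lemma poly_param_const: "poly_param (\<lambda>k x. c)"
  by (rule poly_paramI[of "\<lambda>_ _. c" _ 1]) auto

lemma poly_param_mult_cont:
  assumes "poly_param f" "continuous_on {0..} c"
  shows "poly_param (\<lambda>k x. c x * f k x)"
proof -
  obtain N a where *: "\<And>j. continuous_on {0..} (a j)" "\<And>k x. x \<ge> 0 \<Longrightarrow> f k x = (\<Sum>j<N. k ^ j * a j x)"
    using assms(1) unfolding poly_param_def by blast
  show ?thesis
    by (rule poly_paramI[of "\<lambda>j x. c x * a j x" _ N])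
       (auto intro!: continuous_intros * assms(2) simp: *(2) sum_distrib_left mult_ac)
qed

lemma poly_param_mult_param:
  assumes "poly_param f"
  shows "poly_param (\<lambda>k x. k * f k x)"
proof -
  obtain N a where *: "\<And>j. continuous_on {0..} (a j)" "\<And>k x. x \<ge> 0 \<Longrightarrow> f k x = (\<Sum>j<N. k ^ j * a j x)"
    using assms(1) unfolding poly_param_def by blast
  show ?thesis
  proof (rule poly_paramI[of "\<lambda>j. case j of 0 \<Rightarrow> (\<lambda>_. 0) | Suc i \<Rightarrow> a i" _ "Suc N"])
    show "continuous_on {0..} (case j of 0 \<Rightarrow> (\<lambda>_. 0) | Suc i \<Rightarrow> a i)" for j
      using * by (cases j) auto
  qed (simp add: *(2) sum.lessThan_Suc_shift sum_distrib_left mult_ac del: sum.lessThan_Suc)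
qed

lemma poly_param_add:
  assumes "poly_param f" "poly_param g"
  shows "poly_param (\<lambda>k x. f k x + g k x)"
proof -
  obtain N a where *: "\<And>j. continuous_on {0..} (a j)" "\<And>k x. x \<ge> 0 \<Longrightarrow> f k x = (\<Sum>j<N. k ^ j * a j x)"
    using assms(1) unfolding poly_param_def by blast
  obtain M b where **: "\<And>j. continuous_on {0..} (b j)" "\<And>k x. x \<ge> 0 \<Longrightarrow> g k x = (\<Sum>j<M. k ^ j * b j x)"
    using assms(2) unfolding poly_param_def by blast
  have pad: "(\<Sum>j<N+M. (if j < N then F j else 0)) = (\<Sum>j<N. F j)"
    "(\<Sum>j<N+M. (if j < M then F j else 0)) = (\<Sum>j<M. F j)" for F :: "nat \<Rightarrow> complex"
    by (auto intro!: sum.mono_neutral_cong_right split: if_splits)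
  show ?thesis
  proof (rule poly_paramI[of "\<lambda>j x. (if j < N then a j x else 0) + (if j < M then b j x else 0)" _ "N + M"])
    show "continuous_on {0..} (\<lambda>x. (if j < N then a j x else 0) + (if j < M then b j x else 0))" for j
      using *(1) **(1) by (cases "j < N"; cases "j < M") (auto intro!: continuous_intros)
    show "f k x + g k x = (\<Sum>j<N+M. k ^ j * ((if j < N then a j x else 0) + (if j < M then b j x else 0)))"
      if "x \<ge> 0" for k x
      using that by (simp add: *(2) **(2) distrib_left sum.distrib if_distrib[of "\<lambda>z. _ * z"] pad cong: if_cong)
  qed
qed

lemma continuous_on_atLeastI:
  fixes f :: "real \<Rightarrow> 'a::topological_space"
  assumes "\<And>T. T > a \<Longrightarrow> continuous_on {a..T} f"
  shows "continuous_on {a..} f"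
  unfolding continuous_on_eq_continuous_within
proof
  fix x assume x: "x \<in> {a..}"
  have "at x within {a..} = at x within {a..x+1}"
    by (rule at_within_nhd[of _ "{..<x+1}"]) auto
  moreover have "continuous (at x within {a..x+1}) f"
    using assms[of "x + 1"] x by (auto simp: continuous_on_eq_continuous_within)
  ultimately show "continuous (at x within {a..}) f" by simp
qed

lemma continuous_on_integral_upto:
  fixes f :: "real \<Rightarrow> 'a::banach"
  assumes "continuous_on {0..} f"
  shows "continuous_on {0..} (\<lambda>x. integral {0..x} f)"
proof (rule continuous_on_atLeastI)
  fix T :: real
  have "f integrable_on {0..T}"
    by (rule integrable_continuous_real, rule continuous_on_subset[OF assms]) auto
  then show "continuous_on {0..T} (\<lambda>x. integral {0..x} f)"
    by (rule indefinite_integral_continuous_1)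
qed

text \<open>For solutions of the system, derivatives are two-sided and taken only at
  \<open>x > 0\<close>; the endpoint 0 enters through continuity, in the interior version of the
  fundamental theorem and in the monotonicity rules on open intervals.\<close>

lemma has_vector_derivative_integral_upto:
  fixes f :: "real \<Rightarrow> 'a::banach"
  assumes "continuous_on {0..} f" "x > 0"
  shows "((\<lambda>x. integral {0..x} f) has_vector_derivative f x) (at x)"
proof -
  have "continuous_on {0..x+1} f"
    by (rule continuous_on_subset[OF assms(1)]) auto
  then have "((\<lambda>x. integral {0..x} f) has_vector_derivative f x) (at x within {0..x+1})"
    using assms(2) by (intro integral_has_vector_derivative) auto
  moreover have "at x within {0..x+1} = at x"
    using assms(2) by (intro at_within_interior) auto
  ultimately show ?thesis by simp
qed

lemma integrable_on_upto:
  fixes f :: "real \<Rightarrow> 'a::banach"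
  assumes "continuous_on {0..} f"
  shows "f integrable_on {0..x}"
  by (rule integrable_continuous_real, rule continuous_on_subset[OF assms]) auto

lemma poly_param_integral:
  assumes "poly_param f"
  shows "poly_param (\<lambda>k x. integral {0..x} (f k))"
proof -
  obtain N a where *: "\<And>j. continuous_on {0..} (a j)" "\<And>k x. x \<ge> 0 \<Longrightarrow> f k x = (\<Sum>j<N. k ^ j * a j x)"
    using assms(1) unfolding poly_param_def by blast
  show ?thesis
  proof (rule poly_paramI[of "\<lambda>j x. integral {0..x} (a j)" _ N])
    show "continuous_on {0..} (\<lambda>x. integral {0..x} (a j))" for j
      by (intro continuous_on_integral_upto *)
    show "integral {0..x} (f k) = (\<Sum>j<N. k ^ j * integral {0..x} (a j))" if "x \<ge> 0" for k x
    proof -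
      have "integral {0..x} (f k) = integral {0..x} (\<lambda>t. \<Sum>j<N. k ^ j * a j t)"
        by (intro integral_cong) (simp add: *(2))
      also have "\<dots> = (\<Sum>j<N. integral {0..x} (\<lambda>t. k ^ j * a j t))"
        by (intro integral_sum) (simp, intro integrable_on_upto continuous_on_mult continuous_on_const *(1))
      finally show ?thesis by simp
    qed
  qed
qed

lemma poly_param_continuous:
  assumes "poly_param f"
  shows "continuous_on {0..} (f k)"
proof -
  obtain N a where *: "\<And>j. continuous_on {0..} (a j)" "\<And>k x. x \<ge> 0 \<Longrightarrow> f k x = (\<Sum>j<N. k ^ j * a j x)"
    using assms unfolding poly_param_def by blast
  have "continuous_on {0..} (\<lambda>x. \<Sum>j<N. k ^ j * a j x)"
    by (intro continuous_on_sum continuous_on_mult continuous_on_const *(1))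
  then show ?thesis
    by (rule continuous_on_eq) (simp add: *(2))
qed

lemma poly_param_holomorphic:
  assumes "poly_param f" "x \<ge> 0"
  shows "(\<lambda>k. f k x) holomorphic_on S"
proof -
  obtain N a where *: "\<And>k x. x \<ge> 0 \<Longrightarrow> f k x = (\<Sum>j<N. k ^ j * a j x)"
    using assms(1) unfolding poly_param_def by blast
  show ?thesis
    by (simp add: *[OF assms(2)]) (intro holomorphic_intros)
qed

section \<open>The Picard series for one column\<close>

text \<open>These are the terms of the Picard series, not its partial sums: only term 0 carries the
  initial value \<open>(p, q)\<close>, and each later term is the integral of the system matrix
  applied to its predecessor. The sum over \<open>n\<close> then solves the integral
  equation.\<close>

primrec krein_picard ::
  "(real \<Rightarrow> complex) \<Rightarrow> complex \<Rightarrow> complex \<Rightarrow> nat \<Rightarrow> complex \<Rightarrow> real \<Rightarrow> complex \<times> complex" where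
  "krein_picard A p q 0 k x = (p, q)"
| "krein_picard A p q (Suc n) k x =
     (integral {0..x} (\<lambda>t. \<i> * k * fst (krein_picard A p q n k t) - cnj (A t) * snd (krein_picard A p q n k t)),
      integral {0..x} (\<lambda>t. - A t * fst (krein_picard A p q n k t)))"

context
  fixes A :: "real \<Rightarrow> complex" and p q :: complex
  assumes contA: "continuous_on {0..} A"
begin

lemma poly_param_krein_picard:
  "poly_param (\<lambda>k x. fst (krein_picard A p q n k x)) \<and> poly_param (\<lambda>k x. snd (krein_picard A p q n k x))"
proof (induction n)
  case 0
  then show ?case by (simp add: poly_param_const)
next
  case (Suc n)
  let ?u = "\<lambda>k x. fst (krein_picard A p q n k x)" and ?v = "\<lambda>k x. snd (krein_picard A p q n k x)"
  have "poly_param (\<lambda>k x. \<i> * (k * ?u k x) + (- cnj (A x)) * ?v k x)"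
    using Suc contA
    by (intro poly_param_add poly_param_mult_cont poly_param_mult_param continuous_intros) auto
  then have 1: "poly_param (\<lambda>k x. integral {0..x} (\<lambda>t. \<i> * (k * ?u k t) + (- cnj (A t)) * ?v k t))"
    by (rule poly_param_integral)
  have "poly_param (\<lambda>k x. (- A x) * ?u k x)"
    using Suc contA by (intro poly_param_mult_cont continuous_intros) auto
  then have 2: "poly_param (\<lambda>k x. integral {0..x} (\<lambda>t. - A t * ?u k t))"
    by (rule poly_param_integral)
  show ?case using 1 2 by (simp add: mult.assoc)
qed

lemmas krein_picard_cont =
  poly_param_continuous[OF conjunct1[OF poly_param_krein_picard]]
  poly_param_continuous[OF conjunct2[OF poly_param_krein_picard]]

text \<open>In the sum norm on pairs the system matrix has norm at most \<open>K + B\<close>, the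
  bound for its first column; \<open>n\<close> nested integrations contribute
  \<open>x ^ n / fact n\<close>.\<close>

lemma krein_picard_bound:
  assumes "0 \<le> x" "x \<le> T" "cmod k \<le> K" "\<And>t. t \<in> {0..T} \<Longrightarrow> cmod (A t) \<le> B" "0 \<le> B"
  shows "cmod (fst (krein_picard A p q n k x)) + cmod (snd (krein_picard A p q n k x))
           \<le> (cmod p + cmod q) * ((K + B) * x) ^ n / fact n"
  using assms(1,2)
proof (induction n arbitrary: x)
  case 0
  then show ?case by simp
next
  case (Suc n)
  define u where "u t = fst (krein_picard A p q n k t)" for t
  define v where "v t = snd (krein_picard A p q n k t)" for t
  define C where "C = K + B"
  have K: "K \<ge> 0" using assms(3) norm_ge_zero order_trans by blast
  then have C: "C \<ge> 0" using assms by (simp add: C_def)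
  have cont: "continuous_on {0..x} A" "continuous_on {0..x} u" "continuous_on {0..x} v"
    unfolding u_def v_def
    by (rule continuous_on_subset[OF contA] continuous_on_subset[OF krein_picard_cont(1)]
        continuous_on_subset[OF krein_picard_cont(2)]; force)+
  let ?f = "\<lambda>t. \<i> * k * u t - cnj (A t) * v t" and ?g = "\<lambda>t. - A t * u t"
  have cf: "continuous_on {0..x} ?f" "continuous_on {0..x} ?g"
    using cont by (auto intro!: continuous_intros)
  \<comment> \<open>The bound for \<open>Suc n\<close> is the primitive, vanishing at 0, of
    \<open>C\<close> times the bound for \<open>n\<close>; this closes the induction.\<close>
  have G: "((\<lambda>t. C * ((cmod p + cmod q) * (C * t) ^ n / fact n)) has_integral
        ((cmod p + cmod q) * (C * x) ^ Suc n / fact (Suc n) - (cmod p + cmod q) * (C * 0) ^ Suc n / fact (Suc n))) {0..x}"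
  proof (rule fundamental_theorem_of_calculus)
    fix t assume "t \<in> {0..x}"
    show "((\<lambda>t. (cmod p + cmod q) * (C * t) ^ Suc n / fact (Suc n)) has_vector_derivative
           C * ((cmod p + cmod q) * (C * t) ^ n / fact n)) (at t within {0..x})"
      unfolding has_real_derivative_iff_has_vector_derivative[symmetric]
    proof -
      have "((\<lambda>t. (C * t) ^ Suc n) has_real_derivative real (Suc n) * C * (C * t) ^ n) (at t within {0..x})"
        by (rule DERIV_cong[OF DERIV_power_Suc[OF DERIV_cmult_Id]]) (simp add: mult_ac)
      then have "((\<lambda>t. (cmod p + cmod q) * (C * t) ^ Suc n / fact (Suc n)) has_real_derivative
          (cmod p + cmod q) * (real (Suc n) * C * (C * t) ^ n) / fact (Suc n)) (at t within {0..x})"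
        by (intro DERIV_cdivide DERIV_cmult)
      then show "((\<lambda>t. (cmod p + cmod q) * (C * t) ^ Suc n / fact (Suc n)) has_real_derivative
          C * ((cmod p + cmod q) * (C * t) ^ n / fact n)) (at t within {0..x})"
        by (simp add: fact_Suc mult_ac del: of_nat_Suc power_Suc)
    qed
  qed (use Suc in auto)
  have pt: "cmod (?f t) + cmod (?g t) \<le> C * ((cmod p + cmod q) * (C * t) ^ n / fact n)"
    if t: "t \<in> {0..x}" for t
  proof -
    have A: "cmod (A t) \<le> B" using assms(4) t Suc.prems by auto
    have "cmod (?f t) + cmod (?g t) \<le> cmod k * cmod (u t) + cmod (A t) * cmod (v t) + cmod (A t) * cmod (u t)"
      by (intro add_mono order.trans[OF norm_triangle_ineq4]) (auto simp: norm_mult)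
    also have "\<dots> \<le> K * cmod (u t) + B * cmod (v t) + B * cmod (u t)"
      using A assms(3) by (intro add_mono mult_right_mono) auto
    also have "\<dots> \<le> C * (cmod (u t) + cmod (v t))"
      using K by (simp add: C_def algebra_simps)
    also have "\<dots> \<le> C * ((cmod p + cmod q) * (C * t) ^ n / fact n)"
      using Suc.IH[of t] Suc.prems t C by (intro mult_left_mono) (auto simp: u_def v_def C_def)
    finally show ?thesis .
  qed
  have "cmod (integral {0..x} ?f) + cmod (integral {0..x} ?g)
      \<le> integral {0..x} (\<lambda>t. cmod (?f t)) + integral {0..x} (\<lambda>t. cmod (?g t))"
    by (rule add_mono[OF norm_integral_le[OF cf(1)] norm_integral_le[OF cf(2)]])
  also have "\<dots> = integral {0..x} (\<lambda>t. cmod (?f t) + cmod (?g t))"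
    by (rule integral_add[symmetric]; rule integrable_continuous_real; rule continuous_on_norm; rule cf)
  also have "\<dots> \<le> integral {0..x} (\<lambda>t. C * ((cmod p + cmod q) * (C * t) ^ n / fact n))"
  proof (rule integral_le)
    show "(\<lambda>t. cmod (?f t) + cmod (?g t)) integrable_on {0..x}"
      by (intro integrable_continuous_real continuous_on_add continuous_on_norm cf)
  qed (use G pt in auto)
  also have "\<dots> = (cmod p + cmod q) * (C * x) ^ Suc n / fact (Suc n)"
    using integral_unique[OF G] by simp
  finally show ?case by (simp add: u_def v_def C_def)
qed

text \<open>The majorants depend on neither \<open>x\<close> nor \<open>k\<close>, as the
  Weierstrass test requires: uniformity in \<open>x\<close> gives the integral equation, uniformity
  in \<open>k\<close> gives holomorphy.\<close>

lemma krein_picard_bound_T: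
  assumes "0 \<le> x" "x \<le> T" "cmod k \<le> K" "\<And>t. t \<in> {0..T} \<Longrightarrow> cmod (A t) \<le> B" "0 \<le> B"
  shows "cmod (fst (krein_picard A p q n k x)) \<le> (cmod p + cmod q) * ((K + B) * T) ^ n / fact n"
    and "cmod (snd (krein_picard A p q n k x)) \<le> (cmod p + cmod q) * ((K + B) * T) ^ n / fact n"
proof -
  have "K \<ge> 0" using assms(3) norm_ge_zero order_trans by blast
  then have "(cmod p + cmod q) * ((K + B) * x) ^ n / fact n \<le> (cmod p + cmod q) * ((K + B) * T) ^ n / fact n"
    using assms by (intro divide_right_mono mult_left_mono power_mono mult_right_mono) auto
  moreover have "cmod (fst (krein_picard A p q n k x)) + cmod (snd (krein_picard A p q n k x))
           \<le> (cmod p + cmod q) * ((K + B) * x) ^ n / fact n"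
    by (rule krein_picard_bound[OF assms(1-4)]) (use assms in auto)
  ultimately show "cmod (fst (krein_picard A p q n k x)) \<le> (cmod p + cmod q) * ((K + B) * T) ^ n / fact n"
    and "cmod (snd (krein_picard A p q n k x)) \<le> (cmod p + cmod q) * ((K + B) * T) ^ n / fact n"
    using norm_ge_zero[of "fst (krein_picard A p q n k x)"] norm_ge_zero[of "snd (krein_picard A p q n k x)"]
    by linarith+
qed

lemma coefficient_bounded:
  obtains B where "B \<ge> 0" "\<And>t. t \<in> {0..T} \<Longrightarrow> cmod (A t) \<le> B"
proof -
  have "continuous_on {0..T} A"
    by (rule continuous_on_subset[OF contA]) auto
  then have "bounded (A ` {0..T})"
    by (intro compact_imp_bounded compact_continuous_image) auto
  then obtain B where "B > 0" "\<And>t. t \<in> {0..T} \<Longrightarrow> cmod (A t) \<le> B"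
    unfolding bounded_pos by auto
  then show ?thesis using that[of B] by auto
qed

lemma summable_exp_majorant: "summable (\<lambda>n. (c::real) * y ^ n / fact n)"
  using summable_mult[OF summable_exp[of y], of c] by (simp add: field_simps)

text \<open>One family is produced for all \<open>k\<close> at once: for fixed \<open>x\<close> the
  Picard series converges locally uniformly in \<open>k\<close>, so its sum is entire as a limit of
  polynomials.\<close>

lemma krein_ivp_exists:
  obtains u v :: "complex \<Rightarrow> real \<Rightarrow> complex"
  where "\<And>k. continuous_on {0..} (u k)" "\<And>k. continuous_on {0..} (v k)"
    "\<And>k x. x \<ge> 0 \<Longrightarrow> u k x = p + integral {0..x} (\<lambda>t. \<i> * k * u k t - cnj (A t) * v k t)"
    "\<And>k x. x \<ge> 0 \<Longrightarrow> v k x = q + integral {0..x} (\<lambda>t. - A t * u k t)"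
    "\<And>x. x \<ge> 0 \<Longrightarrow> (\<lambda>k. u k x) holomorphic_on UNIV" "\<And>x. x \<ge> 0 \<Longrightarrow> (\<lambda>k. v k x) holomorphic_on UNIV"
proof -
  define U where "U n k x = fst (krein_picard A p q n k x)" for n k x
  define V where "V n k x = snd (krein_picard A p q n k x)" for n k x
  define u where "u k x = (\<Sum>n. U n k x)" for k x
  define v where "v k x = (\<Sum>n. V n k x)" for k x
  have cUV: "continuous_on S (U n k)" "continuous_on S (V n k)" if "S \<subseteq> {0..}" for n k S
    using continuous_on_subset[OF krein_picard_cont(1) that] continuous_on_subset[OF krein_picard_cont(2) that]
    by (simp_all add: U_def V_def[abs_def] U_def[abs_def])
  have *: "continuous_on {0..T} (u k) \<and> continuous_on {0..T} (v k) \<and>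
     u k T = p + integral {0..T} (\<lambda>t. \<i> * k * u k t - cnj (A t) * v k t) \<and>
     v k T = q + integral {0..T} (\<lambda>t. - A t * u k t)" if T: "T \<ge> 0" for k T
  proof -
    obtain B where B: "B \<ge> 0" "\<And>t. t \<in> {0..T} \<Longrightarrow> cmod (A t) \<le> B" using coefficient_bounded by blast
    define K where "K = cmod k"
    define M where "M n = (cmod p + cmod q) * ((K + B) * T) ^ n / fact n" for n
    have M: "summable M" unfolding M_def by (rule summable_exp_majorant)
    have bd: "cmod (U n k x) \<le> M n" "cmod (V n k x) \<le> M n" if "x \<in> {0..T}" for n x
      using krein_picard_bound_T[of x T k K B n] that B by (auto simp: U_def V_def M_def K_def)
    have bd0: "cmod (U n k x) \<le> norm (M n)" "cmod (V n k x) \<le> norm (M n)" if "x \<in> {0..T}" for n x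
      using bd[OF that, of n] by auto
    have sU: "summable (\<lambda>n. U n k x)" and sV: "summable (\<lambda>n. V n k x)" if "x \<in> {0..T}" for x
      using bd that by (auto intro!: summable_comparison_test[OF _ M])
    have M2: "summable (\<lambda>n. (K + B) * M n)" using M by (rule summable_mult)
    have cA: "continuous_on {0..T} A" by (rule continuous_on_subset[OF contA]) auto
    have cu: "continuous_on {0..T} (u k)" "continuous_on {0..T} (v k)"
      unfolding u_def[abs_def] v_def[abs_def]
      by (rule suminf_integral_M_test(1)[OF _ _ M]; use bd cUV in auto)+
    have "(\<lambda>n. integral {0..T} (\<lambda>t. \<i> * k * U n k t - cnj (A t) * V n k t)) sums
            integral {0..T} (\<lambda>t. \<Sum>n. \<i> * k * U n k t - cnj (A t) * V n k t)"
    proof (rule suminf_integral_M_test(2)[OF _ _ M2])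
      show "continuous_on {0..T} (\<lambda>t. \<i> * k * U n k t - cnj (A t) * V n k t)" for n
        using cA cUV by (auto intro!: continuous_intros)
      show "cmod (\<i> * k * U n k x - cnj (A x) * V n k x) \<le> (K + B) * M n" if "x \<in> {0..T}" for n x
      proof -
        have "cmod (\<i> * k * U n k x - cnj (A x) * V n k x) \<le> K * cmod (U n k x) + cmod (A x) * cmod (V n k x)"
          by (rule order.trans[OF norm_triangle_ineq4]) (auto simp: norm_mult K_def)
        also have "\<dots> \<le> K * M n + B * M n"
          using bd that B by (intro add_mono mult_mono) (auto simp: K_def)
        finally show ?thesis by (simp add: algebra_simps)
      qed
    qed
    also have "integral {0..T} (\<lambda>t. \<Sum>n. \<i> * k * U n k t - cnj (A t) * V n k t) =
        integral {0..T} (\<lambda>t. \<i> * k * u k t - cnj (A t) * v k t)"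
      using sU sV
      by (intro integral_cong) (simp add: u_def v_def suminf_diff[symmetric] suminf_mult[symmetric] summable_mult)
    \<comment> \<open>Integrating the right-hand side for term \<open>n\<close> gives term
      \<open>n + 1\<close> by the recursion, so the shifted series omits exactly the initial
      value.\<close>
    finally have "(\<lambda>n. U (Suc n) k T) sums integral {0..T} (\<lambda>t. \<i> * k * u k t - cnj (A t) * v k t)"
      by (simp add: U_def V_def)
    then have 1: "u k T = p + integral {0..T} (\<lambda>t. \<i> * k * u k t - cnj (A t) * v k t)"
      unfolding u_def[of k T] using sums_Suc[of "\<lambda>n. U n k T"] by (simp add: sums_iff U_def)
    have "(\<lambda>n. integral {0..T} (\<lambda>t. - A t * U n k t)) sums
            integral {0..T} (\<lambda>t. \<Sum>n. - A t * U n k t)"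
    proof (rule suminf_integral_M_test(2)[OF _ _ M2])
      show "continuous_on {0..T} (\<lambda>t. - A t * U n k t)" for n
        using cA cUV by (auto intro!: continuous_intros)
      show "cmod (- A x * U n k x) \<le> (K + B) * M n" if "x \<in> {0..T}" for n x
      proof -
        have "cmod (- A x * U n k x) \<le> B * M n"
          using bd that B by (auto simp: norm_mult intro!: mult_mono)
        also have "\<dots> \<le> (K + B) * M n"
          using order.trans[OF norm_ge_zero bd(1)[OF that]] by (intro mult_right_mono) (auto simp: K_def)
        finally show ?thesis .
      qed
    qed
    also have "integral {0..T} (\<lambda>t. \<Sum>n. - A t * U n k t) = integral {0..T} (\<lambda>t. - A t * u k t)"
      using sU by (intro integral_cong) (simp only: u_def suminf_mult)
    finally have "(\<lambda>n. V (Suc n) k T) sums integral {0..T} (\<lambda>t. - A t * u k t)"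
      by (simp add: U_def V_def)
    then have 2: "v k T = q + integral {0..T} (\<lambda>t. - A t * u k t)"
      unfolding v_def[of k T] using sums_Suc[of "\<lambda>n. V n k T"] by (simp add: sums_iff V_def)
    show ?thesis using cu 1 2 by blast
  qed
  have hol: "(\<lambda>k. u k x) holomorphic_on UNIV \<and> (\<lambda>k. v k x) holomorphic_on UNIV" if x: "x \<ge> 0" for x
  proof -
    obtain B where B: "B \<ge> 0" "\<And>t. t \<in> {0..x} \<Longrightarrow> cmod (A t) \<le> B" using coefficient_bounded by blast
    have lim: "uniform_limit (cball z 1) (\<lambda>n k. \<Sum>i<n. U i k x) (\<lambda>k. u k x) sequentially \<and>
         uniform_limit (cball z 1) (\<lambda>n k. \<Sum>i<n. V i k x) (\<lambda>k. v k x) sequentially" for z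
    proof -
      \<comment> \<open>This number bounds \<open>cmod k\<close> on the unit disc about
        \<open>z\<close>, so one majorant serves the whole disc.\<close>
      define K where "K = cmod z + 1"
      define M where "M n = (cmod p + cmod q) * ((K + B) * x) ^ n / fact n" for n
      have M: "summable M" unfolding M_def by (rule summable_exp_majorant)
      have bd: "cmod (U n k x) \<le> M n" "cmod (V n k x) \<le> M n" if "k \<in> cball z 1" for n k
      proof -
        have "cmod k \<le> K"
          using that norm_triangle_sub[of k z] by (auto simp: K_def dist_norm norm_minus_commute)
        then show "cmod (U n k x) \<le> M n" "cmod (V n k x) \<le> M n"
          using krein_picard_bound_T[of x x k K B n] that B x by (auto simp: U_def V_def M_def)
      qed
      then show ?thesis unfolding u_def v_def
        using M by (intro conjI Weierstrass_m_test) auto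
    qed
    have hs: "(\<lambda>k. \<Sum>i<n. U i k x) holomorphic_on UNIV" "(\<lambda>k. \<Sum>i<n. V i k x) holomorphic_on UNIV" for n
      unfolding U_def V_def using poly_param_krein_picard x
      by (auto intro!: holomorphic_intros poly_param_holomorphic[where f = "\<lambda>k x. fst (krein_picard A p q _ k x)"]
          poly_param_holomorphic[where f = "\<lambda>k x. snd (krein_picard A p q _ k x)"])
    have "(\<lambda>k. u k x) holomorphic_on UNIV"
      by (rule holomorphic_uniform_sequence[OF open_UNIV, where f = "\<lambda>n k. \<Sum>i<n. U i k x"]) (use lim hs in \<open>auto intro!: exI[of _ 1]\<close>)
    moreover have "(\<lambda>k. v k x) holomorphic_on UNIV"
      by (rule holomorphic_uniform_sequence[OF open_UNIV, where f = "\<lambda>n k. \<Sum>i<n. V i k x"]) (use lim hs in \<open>auto intro!: exI[of _ 1]\<close>)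
    ultimately show ?thesis by blast
  qed
  show ?thesis
    by (rule that[of u v]) (use * hol in \<open>auto intro!: continuous_on_atLeastI\<close>)
qed

end

lemma has_real_derivative_cmod_squared:
  assumes "(f has_vector_derivative f') (at x within S)"
  shows "((\<lambda>x. (cmod (f x))\<^sup>2) has_real_derivative 2 * Re (cnj (f x) * f')) (at x within S)"
proof -
  have d: "((\<lambda>x. Re (f x)) has_real_derivative Re f') (at x within S)"
    "((\<lambda>x. Im (f x)) has_real_derivative Im f') (at x within S)"
    using bounded_linear.has_vector_derivative[OF bounded_linear_Re assms]
      bounded_linear.has_vector_derivative[OF bounded_linear_Im assms]
    by (simp_all only: has_real_derivative_iff_has_vector_derivative)
  have "((\<lambda>x. (Re (f x))\<^sup>2 + (Im (f x))\<^sup>2) has_real_derivative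
      2 * Re (cnj (f x) * f')) (at x within S)"
    by (rule DERIV_cong[OF DERIV_add[OF DERIV_power[OF d(1)] DERIV_power[OF d(2)]]]) (simp add: algebra_simps)
  then show ?thesis by (simp add: cmod_power2)
qed

lemma continuous_on_matrix_iff:
  fixes Y :: "'a::topological_space \<Rightarrow> 'b::real_normed_vector^'n^'m"
  shows "continuous_on S Y \<longleftrightarrow> (\<forall>i j. continuous_on S (\<lambda>x. Y x $ i $ j))"
proof
  assume *: "\<forall>i j. continuous_on S (\<lambda>x. Y x $ i $ j)"
  have "continuous_on S (\<lambda>x. \<chi> i. \<chi> j. Y x $ i $ j)"
    by (intro continuous_on_vec_lambda) (use * in auto)
  then show "continuous_on S Y" by simp
qed (intro allI continuous_on_component)

section \<open>Columns, uniqueness and the matrix solution\<close>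

text \<open>The matrix equation acts on each column separately. The column with initial value
  \<open>(0, 1)\<close> is the second one and contains \<open>krein_A\<close>. For continuous
  integrands the Henstock-Kurzweil integral used here agrees with the Lebesgue integral in
  \<open>krein_solution\<close>.\<close>

definition krein_column ::
  "(real \<Rightarrow> complex) \<Rightarrow> complex \<Rightarrow> complex \<Rightarrow> complex \<Rightarrow> (real \<Rightarrow> complex) \<Rightarrow> (real \<Rightarrow> complex) \<Rightarrow> bool" where
  "krein_column A k p q u v \<longleftrightarrow>
     continuous_on {0..} u \<and> continuous_on {0..} v \<and>
     (\<forall>x\<ge>0. u x = p + integral {0..x} (\<lambda>t. \<i> * k * u t - cnj (A t) * v t)) \<and>
     (\<forall>x\<ge>0. v x = q + integral {0..x} (\<lambda>t. - A t * u t))"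

context
  fixes A :: "real \<Rightarrow> complex"
  assumes contA: "continuous_on {0..} A"
begin

lemma krein_column_deriv:
  assumes "krein_column A k p q u v" "x > 0"
  shows "(u has_vector_derivative \<i> * k * u x - cnj (A x) * v x) (at x)"
    and "(v has_vector_derivative - A x * u x) (at x)"
proof -
  have c: "continuous_on {0..} u" "continuous_on {0..} v"
    and e: "\<And>x. x \<ge> 0 \<Longrightarrow> u x = p + integral {0..x} (\<lambda>t. \<i> * k * u t - cnj (A t) * v t)"
      "\<And>x. x \<ge> 0 \<Longrightarrow> v x = q + integral {0..x} (\<lambda>t. - A t * u t)"
    using assms(1) unfolding krein_column_def by auto
  have "((\<lambda>x. p + integral {0..x} (\<lambda>t. \<i> * k * u t - cnj (A t) * v t)) has_vector_derivative
      0 + (\<i> * k * u x - cnj (A x) * v x)) (at x)"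
    using c contA assms(2)
    by (intro has_vector_derivative_add has_vector_derivative_const has_vector_derivative_integral_upto
        continuous_on_diff continuous_on_mult continuous_on_const continuous_on_cnj)
  then have "((\<lambda>x. p + integral {0..x} (\<lambda>t. \<i> * k * u t - cnj (A t) * v t)) has_vector_derivative
      (\<i> * k * u x - cnj (A x) * v x)) (at x)" by simp
  then show "(u has_vector_derivative \<i> * k * u x - cnj (A x) * v x) (at x)"
    by (rule has_vector_derivative_transform_within_open[where S = "{0<..}"]) (use assms e in auto)
  have "((\<lambda>x. q + integral {0..x} (\<lambda>t. - A t * u t)) has_vector_derivative 0 + (- A x * u x)) (at x)"
    using c contA assms(2)
    by (intro has_vector_derivative_add has_vector_derivative_const has_vector_derivative_integral_upto
        continuous_on_minus continuous_on_mult)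
  then have "((\<lambda>x. q + integral {0..x} (\<lambda>t. - A t * u t)) has_vector_derivative - A x * u x) (at x)" by simp
  then show "(v has_vector_derivative - A x * u x) (at x)"
    by (rule has_vector_derivative_transform_within_open[where S = "{0<..}"]) (use assms e in auto)
qed

text \<open>Gronwall's argument: \<open>f = |u|^2 + |v|^2\<close> satisfies
  \<open>f' \<le> C * f\<close> and starts at 0, so the nonincreasing function
  \<open>f * exp (- C * x)\<close> cannot become positive.\<close>

lemma krein_column_zero:
  assumes uv: "krein_column A k 0 0 u v" and x: "x \<ge> 0"
  shows "u x = 0 \<and> v x = 0"
proof -
  obtain B where B: "B \<ge> 0" "\<And>t. t \<in> {0..x} \<Longrightarrow> cmod (A t) \<le> B"
    using coefficient_bounded[OF contA] by blast
  define C where "C = 2 * (cmod k + B)"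
  define f where "f t = (cmod (u t))\<^sup>2 + (cmod (v t))\<^sup>2" for t
  have c: "continuous_on {0..x} u" "continuous_on {0..x} v" and z: "u 0 = 0" "v 0 = 0"
    using uv by (auto simp: krein_column_def intro: continuous_on_subset)
  have "f x * exp (- C * x) \<le> f 0 * exp (- C * 0)"
  proof (rule DERIV_nonpos_imp_decreasing_open[OF x])
    fix t assume t: "0 < t" "t < x"
    define f' where "f' = 2 * Re (cnj (u t) * (\<i> * k * u t - cnj (A t) * v t)) + 2 * Re (cnj (v t) * (- A t * u t))"
    have d: "(f has_real_derivative f') (at t)"
      unfolding f_def[abs_def] f'_def
      by (intro DERIV_add has_real_derivative_cmod_squared krein_column_deriv[OF uv t(1)])
    have "f' \<le> C * f t"
    proof -
      have A: "cmod (A t) \<le> B" using B t by auto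
      have "Re (cnj (u t) * (\<i> * k * u t - cnj (A t) * v t)) \<le> cmod (cnj (u t) * (\<i> * k * u t - cnj (A t) * v t))"
        by (rule complex_Re_le_cmod)
      also have "\<dots> \<le> cmod (u t) * (cmod k * cmod (u t) + cmod (A t) * cmod (v t))"
        unfolding norm_mult complex_mod_cnj
        by (intro mult_left_mono order.trans[OF norm_triangle_ineq4]) (auto simp: norm_mult)
      finally have 1: "Re (cnj (u t) * (\<i> * k * u t - cnj (A t) * v t)) \<le>
          cmod k * (cmod (u t))\<^sup>2 + cmod (A t) * (cmod (u t) * cmod (v t))"
        by (simp add: algebra_simps power2_eq_square)
      have 2: "Re (cnj (v t) * (- A t * u t)) \<le> cmod (A t) * (cmod (u t) * cmod (v t))"
        using complex_Re_le_cmod[of "cnj (v t) * (- A t * u t)"] by (simp add: norm_mult algebra_simps)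
      have 3: "2 * (cmod (u t) * cmod (v t)) \<le> f t"
        using sum_squares_bound[of "cmod (u t)" "cmod (v t)"] by (simp add: f_def)
      have "f' \<le> 2 * (cmod k * (cmod (u t))\<^sup>2) + 2 * cmod (A t) * (2 * (cmod (u t) * cmod (v t)))"
        unfolding f'_def using 1 2 by simp
      also have "\<dots> \<le> 2 * (cmod k * f t) + 2 * B * f t"
        using A 3 B(1) by (intro add_mono mult_left_mono mult_mono) (auto simp: f_def)
      finally show ?thesis by (simp add: C_def algebra_simps)
    qed
    moreover have "((\<lambda>t. f t * exp (- C * t)) has_real_derivative (f' - C * f t) * exp (- C * t)) (at t)"
      by (rule derivative_eq_intros d refl)+ (simp add: algebra_simps)
    ultimately show "\<exists>y. ((\<lambda>t. f t * exp (- C * t)) has_real_derivative y) (at t) \<and> y \<le> 0"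
      by (auto intro!: exI mult_nonpos_nonneg)
  qed (use c in \<open>auto intro!: continuous_intros simp: f_def\<close>)
  then have "f x * exp (- C * x) \<le> 0"
    using z by (simp add: f_def)
  then have "f x \<le> 0"
    by (simp add: mult_le_0_iff)
  then show ?thesis
    by (simp add: f_def sum_power2_le_zero_iff)
qed

lemma krein_column_unique:
  assumes "krein_column A k p q u v" "krein_column A k p q u' v'" "x \<ge> 0"
  shows "u x = u' x \<and> v x = v' x"
proof -
  have c: "continuous_on {0..} u" "continuous_on {0..} v" "continuous_on {0..} u'" "continuous_on {0..} v'"
    using assms unfolding krein_column_def by auto
  have "krein_column A k 0 0 (\<lambda>x. u x - u' x) (\<lambda>x. v x - v' x)"
    unfolding krein_column_def
  proof (intro conjI allI impI)
    fix x :: real assume x: "x \<ge> 0"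
    have "u x - u' x = integral {0..x} (\<lambda>t. \<i> * k * u t - cnj (A t) * v t)
        - integral {0..x} (\<lambda>t. \<i> * k * u' t - cnj (A t) * v' t)"
      using assms x unfolding krein_column_def by simp
    also have "\<dots> = integral {0..x} (\<lambda>t. (\<i> * k * u t - cnj (A t) * v t) - (\<i> * k * u' t - cnj (A t) * v' t))"
      using c contA by (intro integral_diff[symmetric] integrable_on_upto continuous_on_diff
          continuous_on_mult continuous_on_const continuous_on_cnj)
    finally show "u x - u' x = 0 + integral {0..x} (\<lambda>t. \<i> * k * (u t - u' t) - cnj (A t) * (v t - v' t))"
      by (simp add: algebra_simps)
    have "v x - v' x = integral {0..x} (\<lambda>t. - A t * u t) - integral {0..x} (\<lambda>t. - A t * u' t)"
      using assms x unfolding krein_column_def by simp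
    also have "\<dots> = integral {0..x} (\<lambda>t. - A t * u t - - A t * u' t)"
      using c contA by (intro integral_diff[symmetric] integrable_on_upto continuous_on_minus
          continuous_on_mult)
    finally show "v x - v' x = 0 + integral {0..x} (\<lambda>t. - A t * (u t - u' t))"
      by (simp add: algebra_simps)
  qed (use c in \<open>auto intro!: continuous_on_diff\<close>)
  from krein_column_zero[OF this assms(3)] show ?thesis by simp
qed

lemma krein_matrix_mult:
  fixes Y :: "complex^2^2"
  shows "(krein_matrix A k t ** Y) $ 1 $ j = \<i> * k * Y $ 1 $ j - cnj (A t) * Y $ 2 $ j"
    and "(krein_matrix A k t ** Y) $ 2 $ j = - A t * Y $ 1 $ j"
  by (simp_all add: krein_matrix_def matrix_matrix_mult_def sum_2)

lemma continuous_krein_matrix_mult: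
  fixes Y :: "real \<Rightarrow> complex^2^2"
  assumes "continuous_on {0..} Y"
  shows "continuous_on {0..} (\<lambda>t. krein_matrix A k t ** Y t)"
proof -
  have *: "continuous_on {0..} (\<lambda>t. Y t $ i $ j)" for i j
    using assms by (intro continuous_on_component)
  have "continuous_on {0..} (\<lambda>t. krein_matrix A k t ** Y t) \<longleftrightarrow>
     (\<forall>i j. continuous_on {0..} (\<lambda>t. (krein_matrix A k t ** Y t) $ i $ j))"
    by (rule continuous_on_matrix_iff)
  also have "\<dots>"
    unfolding forall_2 krein_matrix_mult using * contA
    by (intro conjI continuous_on_diff continuous_on_minus
          continuous_on_mult continuous_on_const continuous_on_cnj)
  finally show ?thesis by simp
qed

lemma krein_integral_component:
  fixes Y :: "real \<Rightarrow> complex^2^2"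
  assumes "continuous_on {0..} Y"
  shows "(LINT t:{0..x}|lebesgue. krein_matrix A k t ** Y t) $ i $ j =
     integral {0..x} (\<lambda>t. (krein_matrix A k t ** Y t) $ i $ j)"
proof -
  let ?F = "\<lambda>t. krein_matrix A k t ** Y t"
  have c: "continuous_on {0..x} ?F"
    by (rule continuous_on_subset[OF continuous_krein_matrix_mult[OF assms]]) auto
  have "(LINT t:{0..x}|lebesgue. ?F t) = integral {0..x} ?F"
    by (rule set_lebesgue_integral_eq_integral(2)) (rule absolutely_integrable_continuous_real[OF c])
  moreover have "bounded_linear (\<lambda>M::complex^2^2. M $ i $ j)"
    by (intro bounded_linear_compose[OF bounded_linear_vec_nth bounded_linear_vec_nth])
  ultimately show ?thesis
    using integral_linear[OF integrable_continuous_real[OF c], of "\<lambda>M. M $ i $ j"]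
    by (simp add: o_def)
qed

lemma krein_solution_iff_columns:
  "krein_solution A k Y \<longleftrightarrow>
     (\<forall>j. krein_column A k (mat 1 $ 1 $ j) (mat 1 $ 2 $ j) (\<lambda>x. Y x $ 1 $ j) (\<lambda>x. Y x $ 2 $ j))"
proof -
  have cont: "continuous_on {0..} Y \<longleftrightarrow> (\<forall>i j. continuous_on {0..} (\<lambda>t. Y t $ i $ j))"
    by (rule continuous_on_matrix_iff)
  show ?thesis
  proof (cases "continuous_on {0..} Y")
    case True
    have "(\<forall>x\<ge>0. Y x = mat 1 + (LINT t:{0..x}|lebesgue. krein_matrix A k t ** Y t)) \<longleftrightarrow>
       (\<forall>j i. \<forall>x\<ge>0. Y x $ i $ j = mat 1 $ i $ j + integral {0..x} (\<lambda>t. (krein_matrix A k t ** Y t) $ i $ j))"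
      by (auto simp: vec_eq_iff krein_integral_component[OF True])
    also have "\<dots> \<longleftrightarrow> (\<forall>j. krein_column A k (mat 1 $ 1 $ j) (mat 1 $ 2 $ j) (\<lambda>x. Y x $ 1 $ j) (\<lambda>x. Y x $ 2 $ j))"
      using True cont unfolding krein_column_def by (simp add: forall_2[of "\<lambda>i. \<forall>x\<ge>0. _ i x"] krein_matrix_mult)
    finally show ?thesis using True by (simp add: krein_solution_def)
  next
    case False
    then show ?thesis
      unfolding krein_solution_def cont by (auto simp: krein_column_def forall_2)
  qed
qed

lemma krein_column_exists:
  obtains u v :: "complex \<Rightarrow> real \<Rightarrow> complex"
  where "\<And>k. krein_column A k p q (u k) (v k)"
    "\<And>x. x \<ge> 0 \<Longrightarrow> (\<lambda>k. u k x) holomorphic_on UNIV" "\<And>x. x \<ge> 0 \<Longrightarrow> (\<lambda>k. v k x) holomorphic_on UNIV"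
proof (rule krein_ivp_exists[OF contA, of p q])
  fix u v :: "complex \<Rightarrow> real \<Rightarrow> complex"
  assume *: "\<And>k. continuous_on {0..} (u k)" "\<And>k. continuous_on {0..} (v k)"
    "\<And>k x. x \<ge> 0 \<Longrightarrow> u k x = p + integral {0..x} (\<lambda>t. \<i> * k * u k t - cnj (A t) * v k t)"
    "\<And>k x. x \<ge> 0 \<Longrightarrow> v k x = q + integral {0..x} (\<lambda>t. - A t * u k t)"
    "\<And>x. x \<ge> 0 \<Longrightarrow> (\<lambda>k. u k x) holomorphic_on UNIV" "\<And>x. x \<ge> 0 \<Longrightarrow> (\<lambda>k. v k x) holomorphic_on UNIV"
  have "krein_column A k p q (u k) (v k)" for k
    unfolding krein_column_def using *(1-4) by blast
  then show thesis using *(5,6) by (rule that)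
qed

text \<open>\<open>krein_X\<close> is a \<open>SOME\<close> choice made separately for each
  \<open>k\<close>. Since a full matrix solution exists, the choice is one, and uniqueness of its
  second column identifies it with a member of the family that is entire in
  \<open>k\<close>.\<close>

lemma krein_X_column:
  obtains u v :: "complex \<Rightarrow> real \<Rightarrow> complex"
  where "\<And>k. krein_column A k 0 1 (u k) (v k)"
    "\<And>k x. x \<ge> 0 \<Longrightarrow> krein_A x k A = v k x"
    "\<And>x. x \<ge> 0 \<Longrightarrow> (\<lambda>k. u k x) holomorphic_on UNIV" "\<And>x. x \<ge> 0 \<Longrightarrow> (\<lambda>k. v k x) holomorphic_on UNIV"
proof -
  obtain u v where uv: "\<And>k. krein_column A k 0 1 (u k) (v k)"
    and hol: "\<And>x. x \<ge> 0 \<Longrightarrow> (\<lambda>k. u k x) holomorphic_on UNIV" "\<And>x. x \<ge> 0 \<Longrightarrow> (\<lambda>k. v k x) holomorphic_on UNIV"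
    by (rule krein_column_exists[of 0 1]) blast
  obtain u' v' where uv': "\<And>k. krein_column A k 1 0 (u' k) (v' k)"
    by (rule krein_column_exists[of 1 0]) blast
  have "krein_A x k A = v k x" if "x \<ge> 0" for k x
  proof -
    define Y :: "real \<Rightarrow> complex^2^2" where
      "Y x = vector [vector [u' k x, u k x], vector [v' k x, v k x]]" for x
    have "krein_solution A k Y"
      unfolding krein_solution_iff_columns
      using uv[of k] uv'[of k] by (simp add: forall_2 Y_def mat_def)
    then have "krein_solution A k (Eps (krein_solution A k))"
      by (rule someI[of "krein_solution A k"])
    then have "krein_column A k ((mat 1 :: complex^2^2) $ 1 $ 2) ((mat 1 :: complex^2^2) $ 2 $ 2)
        (\<lambda>x. Eps (krein_solution A k) x $ 1 $ 2) (\<lambda>x. Eps (krein_solution A k) x $ 2 $ 2)"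
      unfolding krein_solution_iff_columns by blast
    then have "krein_column A k 0 1 (\<lambda>x. krein_X x k A $ 1 $ 2) (\<lambda>x. krein_X x k A $ 2 $ 2)"
      by (simp add: krein_X_def mat_def)
    from krein_column_unique[OF this uv that] show ?thesis
      by (simp add: krein_A_def)
  qed
  with uv show ?thesis using hol by (rule that)
qed

end

section \<open>The Schwarz formula for the upper half-plane\<close>

text \<open>The primitive is \<open>arctan ((s - a) / b)\<close>. The function serves both as an
  integrable majorant on the line and, for \<open>k = a + \<i> * b\<close>, as the Poisson kernel of
  the Schwarz formula.\<close>

lemma lorentzian_integral:
  fixes a b :: real
  assumes b: "b > 0"
  shows "integrable lborel (\<lambda>s. b / ((s - a)\<^sup>2 + b\<^sup>2))"
    and "(LINT s|lborel. b / ((s - a)\<^sup>2 + b\<^sup>2)) = pi"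
proof -
  let ?f = "\<lambda>s. b / ((s - a)\<^sup>2 + b\<^sup>2)" and ?F = "\<lambda>s. arctan ((s - a) / b)"
  have pos: "(s - a)\<^sup>2 + b\<^sup>2 > 0" for s using b by (simp add: add_nonneg_pos)
  have D: "DERIV ?F s :> ?f s" for s
  proof -
    have "DERIV ?F s :> (1 / b) * inverse (1 + ((s - a) / b)\<^sup>2)"
      using b by (auto intro!: derivative_eq_intros simp: field_simps)
    also have "(1 / b) * inverse (1 + ((s - a) / b)\<^sup>2) = ?f s"
    proof -
      have "1 + ((s - a) / b)\<^sup>2 = ((s - a)\<^sup>2 + b\<^sup>2) / b\<^sup>2" using b by (simp add: field_simps)
      then show ?thesis using b by (simp add: power2_eq_square)
    qed
    finally show ?thesis .
  qed
  have lims: "((?F \<circ> real_of_ereal) \<longlongrightarrow> - (pi / 2)) (at_right (- \<infinity>))"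
    "((?F \<circ> real_of_ereal) \<longlongrightarrow> pi / 2) (at_left \<infinity>)"
  proof -
    have "filterlim (\<lambda>s. (s - a) / b) at_bot at_bot"
      using b by real_asymp
    from filterlim_compose[OF tendsto_arctan_at_bot this]
    show "((?F \<circ> real_of_ereal) \<longlongrightarrow> - (pi / 2)) (at_right (- \<infinity>))"
      by (simp add: ereal_tendsto_simps)
    have "filterlim (\<lambda>s. (s - a) / b) at_top at_top"
      using b by real_asymp
    from filterlim_compose[OF tendsto_arctan_at_top this]
    show "((?F \<circ> real_of_ereal) \<longlongrightarrow> pi / 2) (at_left \<infinity>)"
      by (simp add: ereal_tendsto_simps)
  qed
  have c: "isCont ?f s" for s
    using pos[of s] by (intro continuous_intros) auto
  have nonneg: "0 \<le> ?f s" for s using pos[of s] b by simp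
  note FTC = interval_integral_FTC_nonneg[of "-\<infinity>" "\<infinity>" ?F ?f, OF _ D c _ lims]
  show "integrable lborel ?f"
    using FTC(1) nonneg by (simp add: set_integrable_def)
  show "(LINT s|lborel. ?f s) = pi"
    using FTC(2) nonneg by (simp add: interval_lebesgue_integral_def set_lebesgue_integral_def)
qed

section \<open>Contour integration over half-discs\<close>

lemma closed_upper_half_plane: "closed {z. Im z \<ge> 0}"
  by (intro closed_Collect_le continuous_intros)

lemma interior_upper_half_plane: "interior {z. Im z \<ge> 0} = {z. Im z > 0}"
proof -
  have "{z. Im z \<ge> 0} = {z. \<i> \<bullet> z \<ge> 0}" "{z. Im z > 0} = {z. \<i> \<bullet> z > 0}"
    by (auto simp: inner_complex_def)
  then show ?thesis using interior_halfspace_ge[of \<i> 0] by simp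
qed

lemma continuous_on_real_line:
  assumes "continuous_on {z. Im z \<ge> 0} F"
  shows "continuous_on UNIV (\<lambda>s. F (complex_of_real s))"
  by (rule continuous_on_compose2[OF assms]) (auto intro!: continuous_intros)

lemma upper_half_plane_bound:
  assumes cont: "continuous_on {z. Im z \<ge> 0} F"
    and far: "\<And>z. Im z \<ge> 0 \<Longrightarrow> cmod z \<ge> R \<Longrightarrow> cmod (F z) * (1 + cmod z)\<^sup>2 \<le> C"
  obtains B where "B \<ge> 0" "\<And>z. Im z \<ge> 0 \<Longrightarrow> cmod (F z) * (1 + cmod z)\<^sup>2 \<le> B"
proof -
  have "compact ({z. Im z \<ge> 0} \<inter> cball 0 R)"
    by (intro closed_Int_compact closed_upper_half_plane compact_cball)
  moreover have "continuous_on ({z. Im z \<ge> 0} \<inter> cball 0 R) (\<lambda>z. cmod (F z) * (1 + cmod z)\<^sup>2)"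
    by (intro continuous_intros continuous_on_subset[OF cont]) auto
  ultimately have "bounded ((\<lambda>z. cmod (F z) * (1 + cmod z)\<^sup>2) ` ({z. Im z \<ge> 0} \<inter> cball 0 R))"
    by (intro compact_imp_bounded compact_continuous_image)
  then obtain B where B: "B > 0" "\<And>z. z \<in> {z. Im z \<ge> 0} \<inter> cball 0 R \<Longrightarrow> \<bar>cmod (F z) * (1 + cmod z)\<^sup>2\<bar> \<le> B"
    unfolding bounded_pos by auto
  show ?thesis
  proof (rule that[of "max B C"])
    show "cmod (F z) * (1 + cmod z)\<^sup>2 \<le> max B C" if "Im z \<ge> 0" for z
    proof (cases "cmod z \<le> R")
      case True
      then show ?thesis using B(2)[of z] that by auto
    next
      case False
      then show ?thesis using far[of z] that by auto
    qed
  qed (use B in auto)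
qed

text \<open>Quadratic decay does two things: it makes the line integral absolutely convergent, and
  it bounds the integral over the semicircle of radius \<open>n\<close> by
  \<open>B * pi / n\<close>. Cauchy's theorem on half-discs then forces the limit to be 0.\<close>

lemma real_line_integral_zero:
  assumes cont: "continuous_on {z. Im z \<ge> 0} F"
    and hol: "F holomorphic_on {z. Im z > 0}"
    and far: "\<And>z. Im z \<ge> 0 \<Longrightarrow> cmod z \<ge> R \<Longrightarrow> cmod (F z) * (1 + cmod z)\<^sup>2 \<le> C"
  shows "integrable lborel (\<lambda>s. F (complex_of_real s))"
    and "(LINT s|lborel. F (complex_of_real s)) = 0"
proof -
  obtain B where B: "B \<ge> 0" "\<And>z. Im z \<ge> 0 \<Longrightarrow> cmod (F z) * (1 + cmod z)\<^sup>2 \<le> B"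
    using upper_half_plane_bound[OF cont far] by blast
  let ?F = "\<lambda>s. F (complex_of_real s)"
  have contF: "continuous_on UNIV ?F" by (rule continuous_on_real_line[OF cont])
  then have meas [measurable]: "?F \<in> borel_measurable borel"
    by (rule borel_measurable_continuous_onI)
  show int: "integrable lborel ?F"
  proof (rule Bochner_Integration.integrable_bound)
    show "integrable lborel (\<lambda>s. B * (1 / ((s - 0)\<^sup>2 + 1\<^sup>2)))"
      by (intro integrable_mult_right lorentzian_integral(1)) auto
    have "cmod (?F s) \<le> B * (1 / ((s - 0)\<^sup>2 + 1\<^sup>2))" for s
    proof -
      have "cmod (?F s) * (s\<^sup>2 + 1) \<le> cmod (?F s) * (1 + \<bar>s\<bar>)\<^sup>2"
        by (intro mult_left_mono) (auto simp: power2_eq_square algebra_simps)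
      also have "\<dots> \<le> B" using B(2)[of "of_real s"] by simp
      finally show ?thesis
        by (simp add: pos_le_divide_eq add_nonneg_pos)
    qed
    then show "AE s in lborel. norm (?F s) \<le> norm (B * (1 / ((s - 0)\<^sup>2 + 1\<^sup>2)))"
      by (intro AE_I2) (metis abs_ge_self order.trans real_norm_def)
  qed simp
  have half: "cmod (LINT s|lborel. indicator {- real n..real n} s *\<^sub>R ?F s) \<le> B * pi / real n" if n: "n > 0" for n
  proof -
    let ?arc = "part_circlepath 0 (real n) 0 pi" and ?seg = "linepath (- of_nat n) (of_nat n :: complex)"
    have "path_image ?arc \<subseteq> {z. Im z \<ge> 0}"
    proof
      fix z assume "z \<in> path_image ?arc"
      then obtain t where "0 \<le> t" "t \<le> pi" "z = of_nat n * cis t"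
        by (auto simp: path_image_part_circlepath' closed_segment_eq_real_ivl)
      then show "z \<in> {z. Im z \<ge> 0}"
        by (auto simp: sin_ge_zero)
    qed
    moreover have norm_arc: "cmod z = real n" if "z \<in> path_image ?arc" for z
      using that in_path_image_part_circlepath[of z 0 "real n" 0 pi] by simp
    moreover have seg: "path_image ?seg \<subseteq> {z. Im z \<ge> 0}"
      by (auto simp: closed_segment_def)
    ultimately have "path_image (?arc +++ ?seg) \<subseteq> {z. Im z \<ge> 0}"
      using path_image_join_subset by blast
    \<comment> \<open>The diameter of the half-disc lies on the boundary of the domain of
      holomorphy. This version of Cauchy's theorem asks for continuity on a convex set and
      differentiability only in its interior, here the open half-plane.\<close>
    then have zero: "(F has_contour_integral 0) (?arc +++ ?seg)"
    proof (intro Cauchy_theorem_convex[OF cont, where K = "{}"])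
      show "convex {z. Im z \<ge> 0}" by (rule convex_halfspace_Im_ge)
      show "F field_differentiable at x" if "x \<in> interior {z. Im z \<ge> 0} - {}" for x
        using that holomorphic_on_imp_differentiable_at[OF hol open_halfspace_Im_gt, of x]
        by (simp add: interior_upper_half_plane)
      show "valid_path (?arc +++ ?seg)" by (rule valid_path_join) (simp_all add: exp_Euler)
      show "pathfinish (?arc +++ ?seg) = pathstart (?arc +++ ?seg)" by simp
    qed simp_all
    have ci: "F contour_integrable_on ?arc"
      by (intro contour_integrable_continuous_part_circlepath continuous_on_subset[OF cont]) fact
    have cs: "F contour_integrable_on ?seg"
      by (intro contour_integrable_continuous_linepath continuous_on_subset[OF cont]) (use seg in auto)
    have "contour_integral ?arc F + contour_integral ?seg F = 0"
      using contour_integral_join[OF ci cs] contour_integral_unique[OF zero] by (simp add: exp_Euler)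
    then have "cmod (contour_integral ?seg F) = cmod (contour_integral ?arc F)"
      by (metis add_eq_0_iff norm_minus_cancel)
    also have "\<dots> \<le> (B / (real n)\<^sup>2) * real n * \<bar>pi - 0\<bar>"
    proof (rule contour_integral_bound_part_circlepath[OF ci])
      fix z assume z: "z \<in> path_image ?arc"
      then have "Im z \<ge> 0" using \<open>path_image ?arc \<subseteq> _\<close> by auto
      then have "cmod (F z) * (1 + real n)\<^sup>2 \<le> B" using B(2)[of z] norm_arc[OF z] by simp
      moreover have "cmod (F z) * (real n)\<^sup>2 \<le> cmod (F z) * (1 + real n)\<^sup>2"
        by (intro mult_left_mono power_mono) auto
      ultimately show "cmod (F z) \<le> B / (real n)\<^sup>2" using n by (simp add: field_simps)
    qed (use B in auto)
    also have "\<dots> = B * pi / real n" using n by (simp add: power2_eq_square)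
    finally have "cmod (contour_integral ?seg F) \<le> B * pi / real n" .
    moreover have "(?F has_integral contour_integral ?seg F) {- real n..real n}"
      using has_contour_integral_linepath_Reals_iff[of "- of_nat n" "of_nat n" F "contour_integral ?seg F"] n
        has_contour_integral_integral[OF cs] by simp
    moreover have "(LINT s:{- real n..real n}|lborel. ?F s) = integral {- real n..real n} ?F"
      by (intro set_borel_integral_eq_integral)
         (auto simp: set_integrable_def intro!: integrable_mult_indicator int)
    ultimately show ?thesis
      by (simp add: integral_unique set_lebesgue_integral_def)
  qed
  have "(\<lambda>n. LINT s|lborel. indicator {- real n..real n} s *\<^sub>R ?F s) \<longlonglongrightarrow> (LINT s|lborel. ?F s)"
  proof (rule integral_dominated_convergence[where w = "\<lambda>s. cmod (?F s)"])
    show "AE s in lborel. (\<lambda>n. indicator {- real n..real n} s *\<^sub>R ?F s) \<longlonglongrightarrow> ?F s"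
    proof (intro AE_I2 tendsto_eventually)
      fix s :: real
      obtain N where "real N \<ge> \<bar>s\<bar>" using real_arch_simple by blast
      then show "\<forall>\<^sub>F n in sequentially. indicator {- real n..real n} s *\<^sub>R ?F s = ?F s"
        unfolding eventually_sequentially by (intro exI[of _ N]) (auto simp: indicator_def)
    qed
  qed (use int in \<open>auto simp: indicator_def\<close>)
  moreover have "(\<lambda>n. LINT s|lborel. indicator {- real n..real n} s *\<^sub>R ?F s) \<longlonglongrightarrow> 0"
  proof (rule Lim_null_comparison)
    show "\<forall>\<^sub>F n in sequentially. norm (LINT s|lborel. indicator {- real n..real n} s *\<^sub>R ?F s) \<le> B * pi / real n"
      using eventually_gt_at_top[of 0] by eventually_elim (rule half)
    show "(\<lambda>n. B * pi / real n) \<longlonglongrightarrow> 0" by real_asymp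
  qed
  ultimately show "(LINT s|lborel. ?F s) = 0" by (rule LIMSEQ_unique)
qed

lemma far_from_point:
  assumes "cmod z \<ge> 2 * cmod k + 1"
  shows "1 + cmod z \<le> 4 * cmod (z - k)"
  using assms norm_triangle_ineq2[of z k] norm_ge_zero[of k] by linarith

text \<open>On the real line \<open>2 * Re f = f + cnj f\<close>. The conjugate part divided by
  \<open>s - k\<close> is the conjugate of \<open>f / (s - cnj k)\<close>, which is holomorphic
  above the line and integrates to 0. The other part has a pole at \<open>k\<close>; removing it
  leaves a multiple of the Poisson kernel, whose mass \<open>pi\<close> produces the value
  \<open>f k\<close>.\<close>

theorem Schwarz_formula_upper_half_plane:
  assumes cont: "continuous_on {z. Im z \<ge> 0} f"
    and hol: "f holomorphic_on {z. Im z > 0}"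
    and bound: "\<And>z. Im z \<ge> 0 \<Longrightarrow> cmod (f z) * (1 + cmod z) \<le> C"
    and k: "Im k > 0"
  shows "1 / (of_real pi * \<i>) * (LINT s|lebesgue. of_real (Re (f (of_real s))) / (of_real s - k)) = f k"
proof -
  have C: "C \<ge> 0"
    using order.trans[OF norm_ge_zero, of "f 0" C] bound[of 0] by simp
  have cnj_ne: "z - cnj k \<noteq> 0" if "Im z \<ge> 0" for z
    using that k by (auto simp: complex_eq_iff)
  \<comment> \<open>Subtracting the constant \<open>f k\<close> would also cancel the pole of
    \<open>f z / (z - k)\<close>, but destroy the decay. The fraction takes the value
    \<open>f k\<close> at \<open>k\<close>, decays like \<open>1 / cmod z\<close>, and has its own
    pole in the lower half-plane.\<close>
  define G where "G z = f z - f k * (k - cnj k) / (z - cnj k)" for z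
  define h where "h z = (if z = k then deriv G k else (G z - G k) / (z - k))" for z
  have Gk: "G k = 0" using cnj_ne[of k] k by (simp add: G_def)
  have contG: "continuous_on {z. Im z \<ge> 0} G"
    unfolding G_def[abs_def] using cnj_ne by (intro continuous_intros cont) auto
  have holG: "G holomorphic_on {z. Im z > 0}"
    unfolding G_def[abs_def] using cnj_ne by (intro holomorphic_intros hol) auto
  have holh: "h holomorphic_on {z. Im z > 0}"
    unfolding h_def by (rule pole_lemma_open[OF holG open_halfspace_Im_gt])
  have conth: "continuous_on {z. Im z \<ge> 0} h"
    unfolding continuous_on_eq_continuous_within
  proof
    fix z assume "z \<in> {z. Im z \<ge> 0}"
    then consider "Im z > 0" | "Im z = 0" by fastforce
    then show "continuous (at z within {z. Im z \<ge> 0}) h"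
    proof cases
      case 1
      have "continuous_on {z. Im z > 0} h" by (rule holomorphic_on_imp_continuous_on[OF holh])
      then have "isCont h z"
        using 1 by (simp add: continuous_on_eq_continuous_at open_halfspace_Im_gt)
      then show ?thesis by (rule continuous_at_imp_continuous_within)
    next
      case 2
      then have "z \<noteq> k" using k by auto
      have "continuous (at z within {z. Im z \<ge> 0}) (\<lambda>w. (G w - G k) / (w - k))"
        using contG 2 \<open>z \<noteq> k\<close> by (intro continuous_intros) (auto simp: continuous_on_eq_continuous_within)
      then show "continuous (at z within {z. Im z \<ge> 0}) h"
      proof (rule continuous_transform_within[OF _ k])
        fix w assume "dist w z < Im k"
        then have "\<bar>Im w\<bar> < Im k"
          using abs_Im_le_cmod[of "w - z"] 2 by (simp add: dist_norm)
        then show "(G w - G k) / (w - k) = h w" by (auto simp: h_def)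
      qed (use 2 in auto)
    qed
  qed
  define C1 where "C1 = 4 * (C + C * (8 * cmod k))"
  have farh: "cmod (h z) * (1 + cmod z)\<^sup>2 \<le> C1" if z: "Im z \<ge> 0" "cmod z \<ge> 2 * cmod k + 1" for z
  proof -
    have 1: "1 + cmod z \<le> 4 * cmod (z - k)" "1 + cmod z \<le> 4 * cmod (z - cnj k)"
      using far_from_point[of k z] far_from_point[of "cnj k" z] z by auto
    have fk: "cmod (f k) \<le> C"
      using bound[of k] k mult_left_mono[of 1 "1 + cmod k" "cmod (f k)"] by simp
    have pos: "1 + cmod z > 0" by (simp add: add_pos_nonneg)
    have zk: "z \<noteq> k"
    proof
      assume "z = k"
      with z(2) have "cmod k + 1 \<le> 0" by simp
      with norm_ge_zero[of k] show False by linarith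
    qed
    have "cmod (k - cnj k) \<le> 2 * cmod k"
      using norm_triangle_ineq4[of k "cnj k"] by simp
    have "cmod (f k * (k - cnj k) / (z - cnj k)) * (1 + cmod z) \<le> C * (2 * cmod k) / cmod (z - cnj k) * (4 * cmod (z - cnj k))"
      unfolding norm_mult norm_divide
      by (intro mult_mono divide_right_mono fk 1 C \<open>cmod (k - cnj k) \<le> _\<close>) (auto intro!: C mult_nonneg_nonneg divide_nonneg_nonneg)
    also have "\<dots> = C * (8 * cmod k)"
      using cnj_ne[OF z(1)] by simp
    finally have 2: "cmod (f k * (k - cnj k) / (z - cnj k)) * (1 + cmod z) \<le> C * (8 * cmod k)" .
    have "cmod (G z) * (1 + cmod z) \<le> (cmod (f z) + cmod (f k * (k - cnj k) / (z - cnj k))) * (1 + cmod z)"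
      unfolding G_def using pos by (intro mult_right_mono norm_triangle_ineq4) auto
    also have "\<dots> \<le> C + C * (8 * cmod k)"
      using bound[OF z(1)] 2 by (simp add: distrib_right)
    finally have 3: "cmod (G z) * (1 + cmod z) \<le> C + C * (8 * cmod k)" .
    have "cmod (h z) * (1 + cmod z)\<^sup>2 = (cmod (G z) * (1 + cmod z)) * ((1 + cmod z) / cmod (z - k))"
      using zk by (simp add: h_def Gk norm_divide power2_eq_square)
    also have "\<dots> \<le> (C + C * (8 * cmod k)) * 4"
      using 1(1) zk C pos by (intro mult_mono[OF 3]) (auto simp: field_simps)
    finally show ?thesis by (simp add: C1_def)
  qed
  note h_int = real_line_integral_zero[OF conth holh farh]
  define e where "e z = f z / (z - cnj k)" for z
  have conte: "continuous_on {z. Im z \<ge> 0} e"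
    unfolding e_def[abs_def] using cnj_ne by (intro continuous_intros cont) auto
  have hole: "e holomorphic_on {z. Im z > 0}"
    unfolding e_def[abs_def] using cnj_ne by (intro holomorphic_intros hol) auto
  have fare: "cmod (e z) * (1 + cmod z)\<^sup>2 \<le> C * 4" if z: "Im z \<ge> 0" "cmod z \<ge> 2 * cmod k + 1" for z
  proof -
    have 1: "1 + cmod z \<le> 4 * cmod (z - cnj k)" using far_from_point[of "cnj k" z] z by auto
    have pos: "1 + cmod z > 0" by (simp add: add_pos_nonneg)
    have "cmod (e z) * (1 + cmod z)\<^sup>2 = (cmod (f z) * (1 + cmod z)) * ((1 + cmod z) / cmod (z - cnj k))"
      by (simp add: e_def norm_divide power2_eq_square)
    also have "\<dots> \<le> C * 4"
      using 1 cnj_ne[OF z(1)] C pos by (intro mult_mono[OF bound[OF z(1)]]) (auto simp: field_simps)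
    finally show ?thesis .
  qed
  note e_int = real_line_integral_zero[OF conte hole fare]
  define y where "y = Im k"
  define p where "p s = y / ((s - Re k)\<^sup>2 + y\<^sup>2)" for s
  have y: "y > 0" using k by (simp add: y_def)
  have p_int: "integrable lborel p" "(LINT s|lborel. p s) = pi"
    unfolding p_def[abs_def] by (rule lorentzian_integral[OF y])+
  have decomp: "of_real (Re (f (of_real s))) / (of_real s - k) =
      (h (of_real s) + 2 * \<i> * f k * of_real (p s) + cnj (e (of_real s))) / 2" for s
  proof -
    have ne: "of_real s - k \<noteq> 0" "of_real s - cnj k \<noteq> 0" using k by (auto simp: complex_eq_iff)
    have "(of_real s - k) * (of_real s - cnj k) = of_real ((s - Re k)\<^sup>2 + y\<^sup>2)"
      by (auto simp: complex_eq_iff y_def power2_eq_square algebra_simps)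
    moreover have "k - cnj k = 2 * \<i> * of_real y" by (auto simp: complex_eq_iff y_def)
    ultimately have "2 * \<i> * f k * of_real (p s) = f k * (k - cnj k) / ((of_real s - k) * (of_real s - cnj k))"
      by (simp add: p_def)
    moreover have "h (of_real s) = f (of_real s) / (of_real s - k) - f k * (k - cnj k) / ((of_real s - k) * (of_real s - cnj k))"
      using ne cnj_ne[of k] k by (auto simp: h_def Gk G_def diff_divide_distrib mult_ac)
    moreover have "cnj (e (of_real s)) = cnj (f (of_real s)) / (of_real s - k)"
      by (simp add: e_def)
    moreover have "of_real (Re (f (of_real s))) = (f (of_real s) + cnj (f (of_real s))) / 2"
      by (simp add: complex_eq_iff)
    ultimately show ?thesis by (simp add: add_divide_distrib mult_ac)
  qed
  have cp: "integrable lborel (\<lambda>s. 2 * \<i> * f k * complex_of_real (p s))"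
    "(LINT s|lborel. 2 * \<i> * f k * complex_of_real (p s)) = 2 * \<i> * f k * of_real pi"
    using p_int by simp_all
  have ce: "integrable lborel (\<lambda>s. cnj (e (complex_of_real s)))" "(LINT s|lborel. cnj (e (complex_of_real s))) = 0"
    using e_int by simp_all
  have "(LINT s|lborel. of_real (Re (f (of_real s))) / (of_real s - k)) =
     (LINT s|lborel. (h (complex_of_real s) + 2 * \<i> * f k * of_real (p s) + cnj (e (of_real s))) / 2)"
    by (simp only: decomp)
  also have "\<dots> = \<i> * f k * of_real pi"
    using h_int cp ce by simp
  finally have *: "(LINT s|lborel. of_real (Re (f (of_real s))) / (of_real s - k)) = \<i> * f k * of_real pi" .
  have "continuous_on UNIV (\<lambda>s. complex_of_real (Re (f (of_real s))) / (of_real s - k))"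
    using k by (intro continuous_intros continuous_on_real_line[OF cont]) (auto simp: complex_eq_iff)
  then have "(\<lambda>s. complex_of_real (Re (f (of_real s))) / (of_real s - k)) \<in> borel_measurable lborel"
    by (simp add: borel_measurable_continuous_onI)
  from integral_completion[OF this] * show ?thesis by simp
qed

section \<open>Phase growth while approaching a resonance\<close>

lemma has_real_derivative_Re_Im:
  assumes "(f has_vector_derivative f') (at x within S)"
  shows "((\<lambda>x. Re (f x)) has_real_derivative Re f') (at x within S)"
    and "((\<lambda>x. Im (f x)) has_real_derivative Im f') (at x within S)"
  using bounded_linear.has_vector_derivative[OF bounded_linear_Re assms]
    bounded_linear.has_vector_derivative[OF bounded_linear_Im assms]
  by (simp_all only: has_real_derivative_iff_has_vector_derivative)

text \<open>Here \<open>s\<close> is the detuning \<open>\<xi> - \<phi>'\<close>, followed only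
  while it stays above \<open>D\<close>, and \<open>\<Theta>\<close> is the accumulated phase. With
  \<open>8 * c a \<le> D\<close> the ratio \<open>c / s\<close> never exceeds 1/8, so for frozen
  coefficients the motion of \<open>w\<close> is an elliptic rotation of the disc. The number
  \<open>\<kappa>\<close> bounds \<open>c^2 / (- s')\<close> from below, so that
  \<open>c^2 / s\<close> dominates \<open>\<kappa>\<close> times the derivative of
  \<open>- ln s\<close>.\<close>

locale resonance =
  fixes w :: "real \<Rightarrow> complex" and c c' s s' \<Theta> :: "real \<Rightarrow> real" and a b D \<kappa> :: real
  assumes ab: "a \<le> b"
    and cont: "continuous_on {a..b} w" "continuous_on {a..b} c" "continuous_on {a..b} s" "continuous_on {a..b} \<Theta>"
    and deriv_w: "\<And>t. a < t \<Longrightarrow> t < b \<Longrightarrow>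
       (w has_vector_derivative \<i> * of_real (s t) * w t - of_real (c t) * (1 - (w t)\<^sup>2)) (at t)"
    and deriv_c: "\<And>t. a < t \<Longrightarrow> t < b \<Longrightarrow> (c has_real_derivative c' t) (at t)"
    and deriv_s: "\<And>t. a < t \<Longrightarrow> t < b \<Longrightarrow> (s has_real_derivative s' t) (at t)"
    and deriv_\<Theta>: "\<And>t. a < t \<Longrightarrow> t < b \<Longrightarrow> (\<Theta> has_real_derivative - c t * Im (w t)) (at t)"
    and c_nonneg: "\<And>t. t \<in> {a..b} \<Longrightarrow> c t \<ge> 0"
    and c'_nonpos: "\<And>t. a < t \<Longrightarrow> t < b \<Longrightarrow> c' t \<le> 0"
    and s'_nonpos: "\<And>t. a < t \<Longrightarrow> t < b \<Longrightarrow> s' t \<le> 0"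
    and D: "D > 0" "8 * c a \<le> D" and s_ge: "\<And>t. t \<in> {a..b} \<Longrightarrow> s t \<ge> D"
    and w_less: "\<And>t. t \<in> {a..b} \<Longrightarrow> cmod (w t) < 1" and w_a: "w a = 0"
    and \<kappa>: "\<kappa> \<ge> 0" "\<And>t. a < t \<Longrightarrow> t < b \<Longrightarrow> \<kappa> * (- s' t) \<le> (c t)\<^sup>2"
begin

lemma s_pos: "t \<in> {a..b} \<Longrightarrow> s t > 0"
  using s_ge[of t] D by linarith

lemma c_le: assumes "t \<in> {a..b}" shows "c t \<le> c a"
proof (rule DERIV_nonpos_imp_decreasing_open[of a t])
  show "continuous_on {a..t} c" by (rule continuous_on_subset[OF cont(2)]) (use assms in auto)
  fix x assume "a < x" "x < t"
  then show "\<exists>y. (c has_real_derivative y) (at x) \<and> y \<le> 0"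
    using assms by (intro exI[of _ "c' x"] conjI deriv_c c'_nonpos) auto
qed (use assms in auto)

definition q where "q t = 1 - (cmod (w t))\<^sup>2"

lemma q_eq: "q t = 1 - (Re (w t))\<^sup>2 - (Im (w t))\<^sup>2"
  by (simp add: q_def cmod_power2)

lemma q_bounds: assumes "t \<in> {a..b}" shows "q t > 0" "q t \<le> 1"
  using w_less[OF assms] by (auto simp: q_def power_less_one_iff abs_square_less_1)

text \<open>\<open>P\<close> controls the total variation of \<open>c / s\<close>: its derivative
  dominates the modulus of that of \<open>c / s\<close>, and its total increase is at most
  \<open>2 * c a / D \<le> 1 / 4\<close>. Replacing \<open>s\<close> by \<open>D\<close> in one term
  and \<open>c\<close> by \<open>c a\<close> in the other is what makes the primitive
  explicit.\<close>

definition P where "P t = - c t / D + c a / s t"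

definition P' where "P' t = - c' t / D - c a * s' t / (s t)\<^sup>2"

definition m' where "m' t = (c' t * s t - c t * s' t) / (s t * s t)"

lemma derivs:
  assumes "a < t" "t < b"
  shows "((\<lambda>t. Re (w t)) has_real_derivative - s t * Im (w t) - c t * (1 - (Re (w t))\<^sup>2 + (Im (w t))\<^sup>2)) (at t)"
    and "((\<lambda>t. Im (w t)) has_real_derivative s t * Re (w t) + 2 * c t * Re (w t) * Im (w t)) (at t)"
    and "((\<lambda>t. c t / s t) has_real_derivative m' t) (at t)"
    and "(P has_real_derivative P' t) (at t)"
    and "(q has_real_derivative 2 * c t * Re (w t) * q t) (at t)"
proof -
  show 1: "((\<lambda>t. Re (w t)) has_real_derivative - s t * Im (w t) - c t * (1 - (Re (w t))\<^sup>2 + (Im (w t))\<^sup>2)) (at t)"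
    by (rule DERIV_cong[OF has_real_derivative_Re_Im(1)[OF deriv_w[OF assms]]]) (simp add: power2_eq_square algebra_simps)
  show 2: "((\<lambda>t. Im (w t)) has_real_derivative s t * Re (w t) + 2 * c t * Re (w t) * Im (w t)) (at t)"
    by (rule DERIV_cong[OF has_real_derivative_Re_Im(2)[OF deriv_w[OF assms]]]) (simp add: power2_eq_square algebra_simps)
  have s: "s t \<noteq> 0" using s_pos[of t] assms by auto
  show "((\<lambda>t. c t / s t) has_real_derivative m' t) (at t)"
    unfolding m'_def by (rule DERIV_divide[OF deriv_c[OF assms] deriv_s[OF assms] s])
  show "(P has_real_derivative P' t) (at t)"
    unfolding P_def[abs_def] P'_def using s D(1)
    by (auto intro!: derivative_eq_intros deriv_c[OF assms] deriv_s[OF assms] simp: power2_eq_square)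
  show "(q has_real_derivative 2 * c t * Re (w t) * q t) (at t)"
    unfolding q_eq[abs_def]
    by (rule DERIV_cong[OF DERIV_diff[OF DERIV_diff[OF DERIV_const DERIV_power[OF 1]] DERIV_power[OF 2]]])
       (simp add: power2_eq_square algebra_simps)
qed

lemma m'_le: assumes "a < t" "t < b" shows "\<bar>m' t\<bar> \<le> P' t"
proof -
  have t: "t \<in> {a..b}" using assms by simp
  have s: "s t > 0" "s t \<ge> D" using s_pos s_ge t by auto
  have "m' t = c' t / s t - c t * s' t / (s t)\<^sup>2"
    using s by (simp add: m'_def power2_eq_square diff_divide_distrib)
  then have "\<bar>m' t\<bar> \<le> \<bar>c' t / s t\<bar> + \<bar>c t * s' t / (s t)\<^sup>2\<bar>"
    using abs_triangle_ineq4 by metis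
  also have "\<dots> = - c' t / s t + c t * (- s' t) / (s t)\<^sup>2"
    using s c'_nonpos[OF assms] s'_nonpos[OF assms] c_nonneg[OF t]
    by (simp add: abs_mult abs_divide)
  also have "\<dots> \<le> - c' t / D + c a * (- s' t) / (s t)\<^sup>2"
    using s c'_nonpos[OF assms] s'_nonpos[OF assms] c_le[OF t] D
    by (intro add_mono divide_left_mono divide_right_mono mult_right_mono) auto
  finally show ?thesis by (simp add: P'_def)
qed

lemma P_diff: assumes "t \<in> {a..b}" shows "P t - P a \<le> 1 / 4"
proof -
  have ca: "c a \<ge> 0" "c t \<ge> 0" using c_nonneg assms ab by auto
  have "P t - P a = c a / D - c t / D + c a / s t - c a / s a"
    by (simp add: P_def)
  also have "\<dots> \<le> c a / D + c a / D"
    using ca s_ge[OF assms] s_pos[OF assms] s_pos[of a] D ab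
    by (smt (verit, ccfv_threshold) atLeastAtMost_iff divide_left_mono divide_nonneg_nonneg mult_pos_pos)
  also have "\<dots> \<le> 1 / 4" using D by (simp add: field_simps)
  finally show ?thesis .
qed

lemma c_div_s_le: assumes "t \<in> {a..b}" shows "c t / s t \<le> 1 / 8"
  using c_le[OF assms] s_ge[OF assms] D s_pos[OF assms] by (simp add: field_simps)

text \<open>\<open>E\<close> is the energy of the hyperbolic rotation that \<open>w\<close> undergoes; it would be conserved
  if \<open>c\<close> and \<open>s\<close> were constant.\<close>

definition E where "E t = (2 - q t + 4 * (c t / s t) * Im (w t)) / q t"

lemma deriv_E:
  assumes "a < t" "t < b" shows "(E has_real_derivative 4 * m' t * Im (w t) / q t) (at t)"
proof -
  have q: "q t \<noteq> 0" using q_bounds(1)[of t] assms by simp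
  have s: "s t \<noteq> 0" using s_pos[of t] assms by auto
  note d = derivs[OF assms]
  have alg: "((0 - 2 * C * X * Q + (4 * M * Y + (S * X + 2 * C * X * Y) * (4 * (C / S)))) * Q
      - (2 - Q + 4 * (C / S) * Y) * (2 * C * X * Q)) / (Q * Q) = 4 * M * Y / Q"
    if "Q \<noteq> 0" "S \<noteq> 0" for Q S C X Y M :: real
    using that by (simp add: field_simps)
  show ?thesis
    unfolding E_def[abs_def]
    by (rule DERIV_cong[OF DERIV_divide[OF DERIV_add[OF DERIV_diff[OF DERIV_const d(5)]
            DERIV_mult[OF DERIV_cmult[OF d(3)] d(2)]] d(5) q]]) (rule alg[OF q s])
qed

lemma q_nonzero: "t \<in> {a..b} \<Longrightarrow> q t \<noteq> 0" and s_nonzero: "t \<in> {a..b} \<Longrightarrow> s t \<noteq> 0"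
  using q_bounds(1)[of t] s_pos[of t] by auto

lemma conts: "continuous_on {a..b} q" "continuous_on {a..b} E" "continuous_on {a..b} P"
proof -
  show q: "continuous_on {a..b} q" unfolding q_def[abs_def] by (intro continuous_intros cont)
  show "continuous_on {a..b} E" unfolding E_def[abs_def]
    using q_nonzero s_nonzero by (intro continuous_intros cont q) auto
  show "continuous_on {a..b} P" unfolding P_def[abs_def]
    using D s_nonzero by (intro continuous_intros cont) auto
qed

text \<open>Since \<open>c / s \<le> 1 / 8\<close>, the correction has size at most 1/2 against
  \<open>2 - q \<ge> 1\<close>. A bound on the energy therefore keeps \<open>w\<close> away from the
  unit circle.\<close>

lemma E_ge: assumes "t \<in> {a..b}" shows "1 / (2 * q t) \<le> E t"
proof -
  have q: "q t > 0" "q t \<le> 1" using q_bounds assms by auto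
  have m: "0 \<le> c t / s t" "c t / s t \<le> 1 / 8"
    using c_div_s_le[OF assms] s_pos[OF assms] c_nonneg[OF assms] by simp_all
  have "\<bar>Im (w t)\<bar> \<le> 1" using abs_Im_le_cmod[of "w t"] w_less[OF assms] by linarith
  then have "\<bar>c t / s t * Im (w t)\<bar> \<le> 1 / 8 * 1"
    unfolding abs_mult using m by (intro mult_mono) auto
  then have "2 - q t + 4 * (c t / s t) * Im (w t) \<ge> 1 / 2"
    using q unfolding mult.assoc by linarith
  then have "(1 / 2) / q t \<le> E t"
    unfolding E_def using q by (intro divide_right_mono) auto
  then show ?thesis by (simp add: field_simps)
qed

text \<open>Gronwall's argument with \<open>P\<close> as the clock:
  \<open>E' \<le> 4 * P' / q \<le> 8 * P' * E\<close>, and \<open>P\<close> grows by at most 1/4, so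
  \<open>E\<close> rises from 1 to at most \<open>exp 2 \<le> 15 / 2\<close>. The constant is
  independent of the length of the interval, which matters because the sweeps become ever
  longer.\<close>

lemma q_ge: assumes t: "t \<in> {a..b}" shows "q t \<ge> 1 / 15"
proof -
  have "E t * exp (- 8 * P t) \<le> E a * exp (- 8 * P a)"
  proof (rule DERIV_nonpos_imp_decreasing_open[of a t])
    show "continuous_on {a..t} (\<lambda>t. E t * exp (- 8 * P t))"
      by (rule continuous_on_subset[of "{a..b}"]) (use t in \<open>auto intro!: continuous_intros conts\<close>)
    fix x assume x: "a < x" "x < t"
    then have xb: "x < b" "x \<in> {a..b}" using t by auto
    have q: "q x > 0" using q_bounds xb by simp
    have "((\<lambda>t. E t * exp (- 8 * P t)) has_real_derivative
        (4 * m' x * Im (w x) / q x - 8 * P' x * E x) * exp (- 8 * P x)) (at x)"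
      by (auto intro!: derivative_eq_intros deriv_E derivs(4) x xb simp: algebra_simps)
    moreover have "4 * m' x * Im (w x) / q x \<le> 8 * P' x * E x"
    proof -
      have Y: "\<bar>Im (w x)\<bar> \<le> 1" using abs_Im_le_cmod[of "w x"] w_less[OF xb(2)] by linarith
      have "m' x * Im (w x) \<le> \<bar>m' x\<bar> * \<bar>Im (w x)\<bar>" by (metis abs_ge_self abs_mult)
      also have "\<dots> \<le> P' x * 1"
        using m'_le[OF x(1) xb(1)] Y by (intro mult_mono) auto
      finally have "4 * m' x * Im (w x) / q x \<le> 8 * P' x * (1 / (2 * q x))"
        using q by (simp add: field_simps)
      also have "\<dots> \<le> 8 * P' x * E x"
        using m'_le[OF x(1) xb(1)] E_ge[OF xb(2)] by (intro mult_left_mono) auto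
      finally show ?thesis .
    qed
    ultimately show "\<exists>y. ((\<lambda>t. E t * exp (- 8 * P t)) has_real_derivative y) (at x) \<and> y \<le> 0"
      by (intro exI conjI) (auto intro!: mult_nonpos_nonneg)
  qed (use t in auto)
  moreover have "E a = 1" by (simp add: E_def q_def w_a)
  ultimately have "E t \<le> exp (8 * (P t - P a))"
    by (simp add: exp_diff exp_minus field_simps)
  also have "\<dots> \<le> exp 2" using P_diff[OF t] by simp
  also have "exp (2::real) \<le> 15 / 2"
  proof -
    have "exp (2::real) = exp 1 * exp 1" by (simp flip: exp_add)
    also have "\<dots> \<le> (272 / 100) * (272 / 100)"
      using e_less_272 by (intro mult_mono) auto
    finally show ?thesis by simp
  qed
  finally have "1 / (2 * q t) \<le> 15 / 2" using E_ge[OF t] by linarith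
  then show ?thesis using q_bounds(1)[OF t] by (simp add: field_simps)
qed

text \<open>The equation for \<open>Re w\<close> gives \<open>- c * Im w = (c / s) * (Re w)' + (c^2
  / s) * (1 - (Re w)^2 + (Im w)^2)\<close>. The first term is integrated by parts, and the remainder
  \<open>(c / s)' * Re w\<close> is absorbed by \<open>P\<close>. The second is at least
  \<open>c^2 / (15 * s)\<close> and is the source of the logarithm. The boundary terms cost 1/8 +
  1/4, rounded up to 1.\<close>

lemma angle_growth: "\<Theta> b - \<Theta> a \<ge> \<kappa> / 15 * ln (s a / s b) - 1"
proof -
  define H where "H t = \<Theta> t - (c t / s t) * Re (w t) + P t + \<kappa> / 15 * ln (s t)" for t
  have "H a \<le> H b"
  proof (rule DERIV_nonneg_imp_increasing_open[OF ab])
    show "continuous_on {a..b} H" unfolding H_def[abs_def]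
      using s_nonzero s_pos by (intro continuous_intros cont conts) (auto simp: less_le)
    fix t assume t: "a < t" "t < b"
    then have tab: "t \<in> {a..b}" by simp
    have s: "s t > 0" using s_pos tab by simp
    let ?X = "Re (w t)" and ?Y = "Im (w t)"
    note d = derivs[OF t]
    have dH: "(H has_real_derivative - c t * ?Y
        - (m' t * ?X + (- s t * ?Y - c t * (1 - ?X\<^sup>2 + ?Y\<^sup>2)) * (c t / s t)) + P' t + \<kappa> / 15 * (inverse (s t) * s' t)) (at t)"
      unfolding H_def[abs_def]
      by (intro DERIV_add DERIV_diff DERIV_cmult DERIV_mult d deriv_\<Theta> t DERIV_chain2[OF DERIV_ln deriv_s] s)
    have eq: "- c t * ?Y - (m' t * ?X + (- s t * ?Y - c t * (1 - ?X\<^sup>2 + ?Y\<^sup>2)) * (c t / s t)) + P' t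
        + \<kappa> / 15 * (inverse (s t) * s' t) =
      (P' t - m' t * ?X) + ((c t)\<^sup>2 * (1 - ?X\<^sup>2 + ?Y\<^sup>2) - \<kappa> / 15 * (- s' t)) / s t"
      using s by (simp add: field_simps power2_eq_square)
    have 1: "m' t * ?X \<le> P' t"
    proof -
      have "\<bar>?X\<bar> \<le> 1" using abs_Re_le_cmod[of "w t"] w_less[OF tab] by linarith
      then have "\<bar>m' t\<bar> * \<bar>?X\<bar> \<le> P' t * 1"
        using m'_le[OF t] by (intro mult_mono) auto
      then show ?thesis by (metis abs_ge_self abs_mult mult.right_neutral order.trans)
    qed
    have 2: "(c t)\<^sup>2 * (1 - ?X\<^sup>2 + ?Y\<^sup>2) \<ge> \<kappa> / 15 * (- s' t)"
    proof -
      have "1 - ?X\<^sup>2 + ?Y\<^sup>2 \<ge> q t" by (simp add: q_eq)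
      then have "1 - ?X\<^sup>2 + ?Y\<^sup>2 \<ge> 1 / 15" using q_ge[OF tab] by linarith
      then have "(c t)\<^sup>2 * (1 - ?X\<^sup>2 + ?Y\<^sup>2) \<ge> (c t)\<^sup>2 * (1 / 15)" by (intro mult_left_mono) auto
      then show ?thesis using \<kappa>(2)[OF t] by linarith
    qed
    have "(P' t - m' t * ?X) + ((c t)\<^sup>2 * (1 - ?X\<^sup>2 + ?Y\<^sup>2) - \<kappa> / 15 * (- s' t)) / s t \<ge> 0"
      using 1 2 s by (intro add_nonneg_nonneg divide_nonneg_pos) auto
    with dH show "\<exists>y. (H has_real_derivative y) (at t) \<and> 0 \<le> y"
      unfolding eq by blast
  qed
  then have "\<Theta> a + P a + \<kappa> / 15 * ln (s a) \<le> \<Theta> b - c b / s b * Re (w b) + P b + \<kappa> / 15 * ln (s b)"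
    by (simp add: H_def w_a)
  moreover have "\<bar>c b / s b * Re (w b)\<bar> \<le> 1 / 8 * 1"
  proof -
    have "0 \<le> c b / s b" "c b / s b \<le> 1 / 8" using c_div_s_le[of b] s_pos[of b] c_nonneg[of b] ab by auto
    moreover have "\<bar>Re (w b)\<bar> \<le> 1" using abs_Re_le_cmod[of "w b"] w_less[of b] ab by simp
    ultimately show ?thesis unfolding abs_mult by (intro mult_mono) auto
  qed
  moreover have "P b - P a \<le> 1 / 4" using P_diff ab by simp
  moreover have "\<kappa> / 15 * ln (s a / s b) = \<kappa> / 15 * ln (s a) - \<kappa> / 15 * ln (s b)"
    using s_pos[of a] s_pos[of b] ab by (simp add: ln_div right_diff_distrib diff_divide_distrib)
  ultimately show ?thesis by linarith
qed

end

section \<open>The logarithm of the solution\<close>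

lemma constant_on_if_has_vector_derivative_0:
  fixes f :: "real \<Rightarrow> 'a::banach"
  assumes "a \<le> b" "continuous_on {a..b} f" "\<And>x. a < x \<Longrightarrow> x < b \<Longrightarrow> (f has_vector_derivative 0) (at x)"
  shows "f b = f a"
proof -
  have "((\<lambda>_. 0) has_integral (f b - f a)) {a..b}"
    using assms by (intro fundamental_theorem_of_calculus_interior) auto
  then show ?thesis
    using has_integral_unique[OF has_integral_0] by fastforce
qed

lemma has_vector_derivative_exp:
  fixes f :: "real \<Rightarrow> complex"
  assumes "(f has_vector_derivative f') (at x)"
  shows "((\<lambda>x. exp (f x)) has_vector_derivative f' * exp (f x)) (at x)"
  using field_vector_diff_chain_at[OF assms DERIV_exp] by (simp add: o_def)

section \<open>Measurability of the level sets\<close>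

text \<open>\<open>emeasure\<close> is 0 on sets that are not measurable, so a weak-type bound can
  be contradicted only after the level sets are known to be measurable. A closed superlevel set is a
  countable intersection of open ones at lower levels.\<close>

lemma lower_semicontinuous_superlevel_measurable:
  fixes M :: "real \<Rightarrow> ereal"
  assumes "\<And>s. open {\<xi>. M \<xi> > ereal s}"
  shows "{\<xi>. M \<xi> \<ge> ereal t} \<in> sets lebesgue"
proof -
  have "y \<ge> ereal t \<longleftrightarrow> (\<forall>n. y > ereal (t - 1 / real (Suc n)))" for y
  proof
    assume "y \<ge> ereal t"
    then show "\<forall>n. y > ereal (t - 1 / real (Suc n))"
      by (auto intro: less_le_trans[of _ "ereal t"])
  next
    assume *: "\<forall>n. y > ereal (t - 1 / real (Suc n))"
    show "y \<ge> ereal t"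
    proof (rule ccontr)
      assume "\<not> y \<ge> ereal t"
      with *[rule_format, of 0] obtain r where r: "y = ereal r" "r < t" by (cases y) auto
      then obtain n where "1 / real (Suc n) < t - r"
        using nat_approx_posE[of "t - r"] by (metis diff_gt_0_iff_gt)
      with *[rule_format, of n] r show False by simp
    qed
  qed
  then have "{\<xi>. M \<xi> \<ge> ereal t} = (\<Inter>n. {\<xi>. M \<xi> > ereal (t - 1 / real (Suc n))})" by auto
  also have "\<dots> \<in> sets borel"
    using assms by (intro sets.countable_INT) auto
  finally show ?thesis by simp
qed

text \<open>For fixed \<open>k\<close> the condition \<open>k \<in> stolz_angle \<xi>\<close> is
  open in \<open>\<xi>\<close>, so strict superlevel sets are unions of open intervals, whatever
  values the argument takes.\<close>

lemma krein_maximal_measurable: "{\<xi>. krein_maximal \<xi> A \<ge> ereal t} \<in> sets lebesgue"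
proof (rule lower_semicontinuous_superlevel_measurable)
  fix s
  have "open {\<xi>. k \<in> stolz_angle \<xi>}" for k
  proof (cases "Im k > 0")
    case True
    have "open {\<xi>. \<bar>Re k - \<xi>\<bar> < Im k}" by (intro open_Collect_less continuous_intros)
    with True show ?thesis by (simp add: stolz_angle_def)
  qed (simp add: stolz_angle_def)
  moreover have "{\<xi>. krein_maximal \<xi> A > ereal s} =
      (\<Union>(k, x)\<in>{(k, x). x \<ge> 0 \<and> \<bar>arg_krein_A x k A\<bar> > s}. {\<xi>. k \<in> stolz_angle \<xi>})"
    unfolding krein_maximal_def less_SUP_iff by auto
  ultimately show "open {\<xi>. krein_maximal \<xi> A > ereal s}" by auto
qed

section \<open>The Riccati equation and the continuous branch of the logarithm\<close>

text \<open>Stated for an arbitrary pair because it serves two columns: the one started at 0 and the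
  one restarted at a later time.\<close>

lemma riccati_derivative:
  fixes f g :: "real \<Rightarrow> complex"
  assumes f: "(f has_vector_derivative \<i> * k * f x - cnj c * g x) (at x)"
    and g: "(g has_vector_derivative - c * f x) (at x)" and g0: "g x \<noteq> 0"
  shows "((\<lambda>x. f x / g x) has_vector_derivative \<i> * k * (f x / g x) - cnj c + c * (f x / g x)\<^sup>2) (at x)"
proof -
  have "(inverse has_field_derivative - (inverse (g x) * 1 * inverse (g x))) (at (g x))"
    by (rule DERIV_inverse'[OF DERIV_ident g0])
  from field_vector_diff_chain_at[OF g this]
  have "((\<lambda>x. inverse (g x)) has_vector_derivative - c * f x * - (inverse (g x) * 1 * inverse (g x))) (at x)"
    by (simp add: o_def)
  from has_vector_derivative_mult[OF f this]
  have "((\<lambda>x. f x * inverse (g x)) has_vector_derivative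
     f x * (- c * f x * - (inverse (g x) * 1 * inverse (g x))) + (\<i> * k * f x - cnj c * g x) * inverse (g x)) (at x)" .
  moreover have "f x * (- c * f x * - (inverse (g x) * 1 * inverse (g x))) + (\<i> * k * f x - cnj c * g x) * inverse (g x) =
     \<i> * k * (f x / g x) - cnj c + c * (f x / g x)\<^sup>2"
    using g0 by (simp add: field_simps power2_eq_square)
  ultimately show ?thesis by (simp add: divide_inverse)
qed

text \<open>A coefficient of class C1 permits the integration by parts behind the decay of the
  logarithm as \<open>k\<close> tends to infinity; this is where \<open>A'\<close> enters.\<close>

locale krein_C1 =
  fixes A A' :: "real \<Rightarrow> complex" and u v :: "complex \<Rightarrow> real \<Rightarrow> complex"
  assumes contA: "continuous_on {0..} A" and contA': "continuous_on {0..} A'"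
    and derivA: "\<And>x. x > 0 \<Longrightarrow> (A has_vector_derivative A' x) (at x)"
    and column: "\<And>k. krein_column A k 0 1 (u k) (v k)"
    and krein_A_eq: "\<And>k x. x \<ge> 0 \<Longrightarrow> krein_A x k A = v k x"
    and hol_u: "\<And>x. x \<ge> 0 \<Longrightarrow> (\<lambda>k. u k x) holomorphic_on UNIV"
    and hol_v: "\<And>x. x \<ge> 0 \<Longrightarrow> (\<lambda>k. v k x) holomorphic_on UNIV"
begin

lemmas deriv_u = krein_column_deriv(1)[OF contA column]
lemmas deriv_v = krein_column_deriv(2)[OF contA column]

lemma cont_uv: "continuous_on {0..} (u k)" "continuous_on {0..} (v k)"
  and init_uv: "u k 0 = 0" "v k 0 = 1"
  using column[of k] by (auto simp: krein_column_def)

definition schur :: "complex \<Rightarrow> real \<Rightarrow> complex" where "schur k x = u k x / v k x"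

text \<open>Obtained by integrating \<open>v' / v\<close>, hence a branch continuous in
  \<open>x\<close> that vanishes at \<open>x = 0\<close>. The principal value \<open>Ln\<close>
  would confine the phase to an interval of length \<open>2 * pi\<close>, whereas its growth is the
  object of study.\<close>

definition logv :: "complex \<Rightarrow> real \<Rightarrow> complex" where
  "logv k x = - integral {0..x} (\<lambda>t. A t * schur k t)"

text \<open>The terms with \<open>A\<close> are skew for the indefinite form
  \<open>|v|^2 - |u|^2\<close> and cancel; only the entry \<open>\<i> * k\<close> contributes. The
  form is thus nondecreasing in \<open>x\<close> for \<open>Im k \<ge> 0\<close> and conserved for
  real \<open>k\<close>.\<close>

lemma deriv_pseudo_norm:
  assumes "x > 0"
  shows "((\<lambda>x. (cmod (v k x))\<^sup>2 - (cmod (u k x))\<^sup>2) has_real_derivative 2 * Im k * (cmod (u k x))\<^sup>2) (at x)"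
  by (rule DERIV_cong[OF DERIV_diff[OF has_real_derivative_cmod_squared has_real_derivative_cmod_squared]],
      rule deriv_v[OF assms], rule deriv_u[OF assms])
     (simp add: cmod_power2, simp add: algebra_simps power2_eq_square)

lemma pseudo_norm_ge_1:
  assumes "Im k \<ge> 0" "x \<ge> 0"
  shows "(cmod (v k x))\<^sup>2 - (cmod (u k x))\<^sup>2 \<ge> 1"
proof -
  have "(cmod (v k 0))\<^sup>2 - (cmod (u k 0))\<^sup>2 \<le> (cmod (v k x))\<^sup>2 - (cmod (u k x))\<^sup>2"
  proof (rule DERIV_nonneg_imp_increasing_open[OF assms(2)])
    fix t assume "0 < t" "t < x"
    then show "\<exists>y. ((\<lambda>x. (cmod (v k x))\<^sup>2 - (cmod (u k x))\<^sup>2) has_real_derivative y) (at t) \<and> 0 \<le> y"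
      using deriv_pseudo_norm[of t k] assms(1) by (intro exI[of _ "2 * Im k * (cmod (u k t))\<^sup>2"]) auto
  qed (auto intro!: continuous_intros continuous_on_subset[OF cont_uv(1)] continuous_on_subset[OF cont_uv(2)])
  then show ?thesis by (simp add: init_uv)
qed

lemma pseudo_norm_eq_1:
  assumes "Im k = 0" "x \<ge> 0"
  shows "(cmod (v k x))\<^sup>2 - (cmod (u k x))\<^sup>2 = 1"
proof -
  have "(cmod (v k x))\<^sup>2 - (cmod (u k x))\<^sup>2 = (cmod (v k 0))\<^sup>2 - (cmod (u k 0))\<^sup>2"
  proof (rule constant_on_if_has_vector_derivative_0[OF assms(2)])
    fix t assume "0 < t" "t < x"
    then show "((\<lambda>x. (cmod (v k x))\<^sup>2 - (cmod (u k x))\<^sup>2) has_vector_derivative 0) (at t)"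
      using deriv_pseudo_norm[of t k] assms(1) by (simp add: has_real_derivative_iff_has_vector_derivative)
  qed (auto intro!: continuous_intros continuous_on_subset[OF cont_uv(1)] continuous_on_subset[OF cont_uv(2)])
  then show ?thesis by (simp add: init_uv)
qed

lemma v_bounds:
  assumes "Im k \<ge> 0" "x \<ge> 0"
  shows "cmod (v k x) \<ge> 1" "v k x \<noteq> 0" "cmod (schur k x) \<le> 1"
proof -
  have *: "(cmod (v k x))\<^sup>2 \<ge> 1 + (cmod (u k x))\<^sup>2" using pseudo_norm_ge_1[OF assms] by simp
  then have "(cmod (v k x))\<^sup>2 \<ge> 1\<^sup>2" by (smt (verit) one_power2 zero_le_power2)
  then show 1: "cmod (v k x) \<ge> 1" by (rule power2_le_imp_le) simp
  then show "v k x \<noteq> 0" by auto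
  have "(cmod (u k x))\<^sup>2 \<le> (cmod (v k x))\<^sup>2" using * by linarith
  then have "cmod (u k x) \<le> cmod (v k x)" by (rule power2_le_imp_le) simp
  then show "cmod (schur k x) \<le> 1" using 1 by (simp add: schur_def norm_divide divide_le_eq_1)
qed

lemma cont_schur:
  assumes "Im k \<ge> 0" shows "continuous_on {0..} (schur k)"
  unfolding schur_def using v_bounds(2)[OF assms] by (intro continuous_intros cont_uv) auto

lemma deriv_schur:
  assumes "Im k \<ge> 0" "x > 0"
  shows "(schur k has_vector_derivative \<i> * k * schur k x - cnj (A x) + A x * (schur k x)\<^sup>2) (at x)"
proof -
  have v: "v k x \<noteq> 0" using v_bounds(2) assms by simp
  show ?thesis
    unfolding schur_def by (rule riccati_derivative[OF deriv_u deriv_v]) (use assms v in auto)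
qed

lemma cont_A_schur: "Im k \<ge> 0 \<Longrightarrow> continuous_on {0..} (\<lambda>t. A t * schur k t)"
  by (intro continuous_on_mult contA cont_schur)

lemma cont_logv: "Im k \<ge> 0 \<Longrightarrow> continuous_on {0..} (logv k)"
  unfolding logv_def[abs_def] by (intro continuous_on_minus continuous_on_integral_upto cont_A_schur)

lemma deriv_logv:
  assumes "Im k \<ge> 0" "x > 0" shows "(logv k has_vector_derivative - (A x * schur k x)) (at x)"
  unfolding logv_def[abs_def]
  by (intro has_vector_derivative_minus has_vector_derivative_integral_upto cont_A_schur assms)

lemma exp_logv:
  assumes "Im k \<ge> 0" "x \<ge> 0" shows "exp (logv k x) = v k x"
proof -
  have "v k x * exp (- logv k x) = v k 0 * exp (- logv k 0)"
  proof (rule constant_on_if_has_vector_derivative_0[OF assms(2)])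
    show "continuous_on {0..x} (\<lambda>x. v k x * exp (- logv k x))"
      by (intro continuous_intros continuous_on_subset[OF cont_logv[OF assms(1)]] continuous_on_subset[OF cont_uv(2)]) auto
    fix t assume t: "0 < t" "t < x"
    have v: "v k t \<noteq> 0" using v_bounds(2) assms t by simp
    have "((\<lambda>x. v k x * exp (- logv k x)) has_vector_derivative
      v k t * (- (- (A t * schur k t)) * exp (- logv k t)) + (- A t * u k t) * exp (- logv k t)) (at t)"
      by (intro has_vector_derivative_mult has_vector_derivative_exp has_vector_derivative_minus
          deriv_logv deriv_v assms t)
    then show "((\<lambda>x. v k x * exp (- logv k x)) has_vector_derivative 0) (at t)"
      using v by (simp add: schur_def)
  qed
  then show ?thesis by (simp add: init_uv logv_def exp_minus field_simps)
qed

text \<open>The Riccati equation writes \<open>\<i> * k * schur\<close> as the derivative of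
  \<open>schur\<close> plus terms bounded independently of \<open>k\<close>. Integrating
  \<open>A\<close> times that derivative by parts bounds \<open>cmod k * cmod (logv k x)\<close> by
  a constant free of \<open>k\<close>, because \<open>schur\<close> has modulus at most 1. This is
  the decay that the Schwarz formula asks for.\<close>

lemma logv_bound:
  assumes x: "x \<ge> 0"
  obtains C where "\<And>k. Im k \<ge> 0 \<Longrightarrow> cmod (logv k x) * (1 + cmod k) \<le> C"
proof -
  obtain B where B: "B \<ge> 0" "\<And>t. t \<in> {0..x} \<Longrightarrow> cmod (A t) \<le> B"
    using coefficient_bounded[OF contA] by blast
  obtain B' where B': "B' \<ge> 0" "\<And>t. t \<in> {0..x} \<Longrightarrow> cmod (A' t) \<le> B'"
    using coefficient_bounded[OF contA'] by blast
  have "cmod (logv k x) * (1 + cmod k) \<le> B * x + (B + (B' + 2 * B\<^sup>2) * x)" if k: "Im k \<ge> 0" for k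
  proof -
    have r: "cmod (schur k t) \<le> 1" if "t \<in> {0..x}" for t using v_bounds(3)[OF k] that by simp
    have cA: "continuous_on {0..x} A" "continuous_on {0..x} A'" "continuous_on {0..x} (schur k)"
      by (rule continuous_on_subset[OF contA] continuous_on_subset[OF contA'] continuous_on_subset[OF cont_schur[OF k]]; force)+
    have 1: "cmod (logv k x) \<le> B * (x - 0)"
      unfolding logv_def norm_minus_cancel
    proof (rule integral_bound[OF x])
      show "cmod (A t * schur k t) \<le> B" if "t \<in> {0..x}" for t
        using mult_mono[OF B(2)[OF that] r[OF that]] B(1) by (simp add: norm_mult)
    qed (intro continuous_on_mult cA)
    let ?I = "\<lambda>t. A' t * schur k t + (A t)\<^sup>2 * (schur k t)\<^sup>2 - A t * cnj (A t)"
    have cI: "continuous_on {0..x} ?I" using cA by (intro continuous_intros) auto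
    have FTC: "((\<lambda>t. A t * (\<i> * k * schur k t - cnj (A t) + A t * (schur k t)\<^sup>2) + A' t * schur k t) has_integral
        (A x * schur k x - A 0 * schur k 0)) {0..x}"
    proof (rule fundamental_theorem_of_calculus_interior[OF x])
      show "continuous_on {0..x} (\<lambda>t. A t * schur k t)" using cA by (intro continuous_intros)
      show "((\<lambda>t. A t * schur k t) has_vector_derivative
          A t * (\<i> * k * schur k t - cnj (A t) + A t * (schur k t)\<^sup>2) + A' t * schur k t) (at t)" if "t \<in> {0<..<x}" for t
        using that by (intro has_vector_derivative_mult derivA deriv_schur k) auto
    qed
    have "((\<lambda>t. \<i> * k * (A t * schur k t) + ?I t) has_integral \<i> * k * (- logv k x) + integral {0..x} ?I) {0..x}"
      unfolding logv_def minus_minus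
      by (intro has_integral_add has_integral_mult_right integrable_integral integrable_continuous_real cI continuous_on_mult cA)
    moreover have "(\<lambda>t. \<i> * k * (A t * schur k t) + ?I t) =
      (\<lambda>t. A t * (\<i> * k * schur k t - cnj (A t) + A t * (schur k t)\<^sup>2) + A' t * schur k t)"
      by (simp add: algebra_simps power2_eq_square)
    ultimately have "\<i> * k * (- logv k x) + integral {0..x} ?I = A x * schur k x - A 0 * schur k 0"
      using has_integral_unique[OF _ FTC] by simp
    then have eq: "\<i> * k * logv k x = integral {0..x} ?I - A x * schur k x"
      by (simp add: schur_def init_uv algebra_simps)
    have "cmod (integral {0..x} ?I) \<le> (B' + 2 * B\<^sup>2) * (x - 0)"
    proof (rule integral_bound[OF x cI])
      fix t assume t: "t \<in> {0..x}"
      have "cmod (A' t * schur k t) \<le> B' * 1" unfolding norm_mult using B' r t by (intro mult_mono) auto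
      moreover have "cmod ((A t)\<^sup>2 * (schur k t)\<^sup>2) \<le> B\<^sup>2 * 1"
        unfolding norm_mult norm_power using B r t by (intro mult_mono power_mono) (auto simp: power_le_one)
      moreover have "cmod (A t * cnj (A t)) \<le> B\<^sup>2"
        unfolding norm_mult power2_eq_square using B t by (intro mult_mono) auto
      moreover have "cmod (?I t) \<le> cmod (A' t * schur k t) + cmod ((A t)\<^sup>2 * (schur k t)\<^sup>2) + cmod (A t * cnj (A t))"
        by (intro order.trans[OF norm_triangle_ineq4] add_mono norm_triangle_ineq order_refl)
      ultimately show "cmod (?I t) \<le> B' + 2 * B\<^sup>2" by linarith
    qed
    moreover have "cmod (A x * schur k x) \<le> B"
      using mult_mono[OF B(2)[of x] r[of x]] B(1) x by (simp add: norm_mult)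
    moreover have "cmod (\<i> * k * logv k x) = cmod k * cmod (logv k x)" by (simp add: norm_mult)
    ultimately have "cmod k * cmod (logv k x) \<le> B + (B' + 2 * B\<^sup>2) * x"
      using norm_triangle_ineq4[of "integral {0..x} ?I" "A x * schur k x"] unfolding eq by simp
    with 1 show ?thesis by (simp add: algebra_simps)
  qed
  then show ?thesis by (rule that)
qed

text \<open>Dominated convergence along sequences, with \<open>cmod (A t)\<close> as the dominating
  function. The real line is included, which later provides the boundary values of the
  argument.\<close>

lemma logv_continuous_in_k:
  assumes x: "x \<ge> 0" shows "continuous_on {k. Im k \<ge> 0} (\<lambda>k. logv k x)"
  unfolding continuous_on_sequentially
proof (intro allI ballI impI)
  fix K :: "nat \<Rightarrow> complex" and k
  assume "k \<in> {k. Im k \<ge> 0}" and "(\<forall>n. K n \<in> {k. Im k \<ge> 0}) \<and> K \<longlonglongrightarrow> k"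
  then have k: "Im k \<ge> 0" and K: "\<And>n. Im (K n) \<ge> 0" "K \<longlonglongrightarrow> k" by auto
  have "(\<lambda>n. integral {0..x} (\<lambda>t. A t * schur (K n) t)) \<longlonglongrightarrow> integral {0..x} (\<lambda>t. A t * schur k t)"
  proof (rule dominated_convergence(2))
    show "(\<lambda>t. A t * schur (K n) t) integrable_on {0..x}" for n
      by (intro integrable_on_upto cont_A_schur K)
    show "(\<lambda>t. cmod (A t)) integrable_on {0..x}"
      by (intro integrable_on_upto continuous_on_norm contA)
    show "norm (A t * schur (K n) t) \<le> cmod (A t)" if "t \<in> {0..x}" for n t
      using v_bounds(3)[OF K(1), of t n] that by (simp add: norm_mult mult_left_le)
    show "(\<lambda>n. A t * schur (K n) t) \<longlonglongrightarrow> A t * schur k t" if "t \<in> {0..x}" for t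
    proof -
      have "isCont (\<lambda>k. u k t) k" "isCont (\<lambda>k. v k t) k"
        using holomorphic_on_imp_continuous_on[OF hol_u, of t] holomorphic_on_imp_continuous_on[OF hol_v, of t] that
        by (auto simp: continuous_on_eq_continuous_at)
      then show ?thesis
        unfolding schur_def using v_bounds(2)[OF k, of t] that
        by (intro tendsto_intros isCont_tendsto_compose[OF _ K(2)]) auto
    qed
  qed
  then show "((\<lambda>k. logv k x) \<circ> K) \<longlonglongrightarrow> logv k x"
    by (simp add: logv_def o_def tendsto_minus)
qed

text \<open>Near \<open>z\<close>, continuity keeps \<open>logv w x - logv z x\<close> within
  distance 1 of 0, inside the strip where \<open>Ln\<close> inverts \<open>exp\<close>. So
  \<open>logv\<close> is locally a constant plus \<open>Ln\<close> of a holomorphic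
  quotient.\<close>

lemma logv_holomorphic:
  assumes x: "x \<ge> 0" shows "(\<lambda>k. logv k x) holomorphic_on {k. Im k > 0}"
  unfolding holomorphic_on_def
proof
  fix z assume z: "z \<in> {k. Im k > 0}"
  have ez: "v z x \<noteq> 0" using z x v_bounds(2)[of z x] by simp
  have "continuous_on {k. Im k > 0} (\<lambda>k. logv k x)"
    by (rule continuous_on_subset[OF logv_continuous_in_k[OF x]]) auto
  then have "isCont (\<lambda>k. logv k x) z"
    using z by (simp add: continuous_on_eq_continuous_at open_halfspace_Im_gt)
  then have "\<forall>\<^sub>F w in nhds z. dist (logv w x) (logv z x) < 1"
    unfolding isCont_def tendsto_at_iff_tendsto_nhds[of "\<lambda>k. logv k x"] by (rule tendstoD) simp
  moreover have "\<forall>\<^sub>F w in nhds z. w \<in> {k. Im k > 0}"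
    using z by (intro eventually_nhds_in_open open_halfspace_Im_gt)
  ultimately have ev: "\<forall>\<^sub>F w in nhds z. logv w x = logv z x + Ln (v w x / v z x)"
  proof eventually_elim
    case (elim w)
    have "\<bar>Im (logv w x - logv z x)\<bar> < 1"
      using abs_Im_le_cmod[of "logv w x - logv z x"] elim(1) by (simp add: dist_norm)
    then have "Ln (exp (logv w x - logv z x)) = logv w x - logv z x"
      using pi_gt3 by (intro Ln_exp) auto
    moreover have "exp (logv w x - logv z x) = v w x / v z x"
      using elim(2) z x by (simp add: exp_diff exp_logv)
    ultimately show ?case by simp
  qed
  have "(\<lambda>k. v k x) field_differentiable at z"
    using hol_v[OF x] by (simp add: holomorphic_on_def)
  then have "(\<lambda>w. logv z x + Ln (v w x / v z x)) field_differentiable at z"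
    using ez by (intro field_differentiable_add field_differentiable_const field_differentiable_divide
        field_differentiable_compose[of "\<lambda>w. v w x / v z x" _ Ln, unfolded o_def] field_differentiable_at_Ln) auto
  then have "(\<lambda>k. logv k x) field_differentiable at z"
    unfolding field_differentiable_def using DERIV_cong_ev[OF refl ev refl] by blast
  then show "(\<lambda>k. logv k x) field_differentiable at z within {k. Im k > 0}"
    by (rule field_differentiable_at_within)
qed

lemma ln_cmod_v: "Im k \<ge> 0 \<Longrightarrow> x \<ge> 0 \<Longrightarrow> ln (cmod (v k x)) = Re (logv k x)"
  by (simp flip: exp_logv)

text \<open>On the line \<open>ln |v|\<close> is the real part of \<open>logv\<close>, and the
  Schwarz formula recovers \<open>logv\<close> from it. The decay at infinity is what makes the
  branch obtained by integration in \<open>x\<close> agree with the one that vanishes at infinity in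
  \<open>k\<close>.\<close>

lemma arg_krein_A_upper_eq:
  assumes "x \<ge> 0" "Im k > 0" shows "arg_krein_A_upper x k A = Im (logv k x)"
proof -
  obtain C where "\<And>k. Im k \<ge> 0 \<Longrightarrow> cmod (logv k x) * (1 + cmod k) \<le> C"
    using logv_bound[OF assms(1)] by blast
  from Schwarz_formula_upper_half_plane[OF logv_continuous_in_k[OF assms(1)] logv_holomorphic[OF assms(1)] this assms(2)]
  have Schwarz: "1 / (of_real pi * \<i>) * (LINT s|lebesgue. of_real (Re (logv (of_real s) x)) / (of_real s - k)) = logv k x"
    by blast
  have "ln (cmod (krein_A x (of_real s) A)) = Re (logv (of_real s) x)" for s
    by (simp add: krein_A_eq[OF assms(1)] ln_cmod_v assms(1))
  then show ?thesis
    by (simp only: arg_krein_A_upper_def Schwarz)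
qed

lemma arg_krein_A_eq:
  assumes x: "x \<ge> 0" and k: "Im k \<ge> 0" shows "arg_krein_A x k A = Im (logv k x)"
proof (cases "Im k > 0")
  case True
  then show ?thesis using arg_krein_A_upper_eq[OF x] by (simp add: arg_krein_A_def)
next
  case False
  let ?F = "at k within {z. Im z > 0}"
  have "((\<lambda>z. Im (logv z x)) \<longlongrightarrow> Im (logv k x)) (at k within {z. Im z \<ge> 0})"
    using logv_continuous_in_k[OF x] k by (intro tendsto_intros) (simp add: continuous_on_def)
  then have "((\<lambda>z. Im (logv z x)) \<longlongrightarrow> Im (logv k x)) ?F"
    by (rule tendsto_within_subset) auto
  then have "((\<lambda>z. arg_krein_A_upper x z A) \<longlongrightarrow> Im (logv k x)) ?F"
    by (rule Lim_transform_eventually) (auto simp: eventually_at_filter arg_krein_A_upper_eq[OF x])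
  moreover have "?F \<noteq> bot"
  proof -
    have "closure {z. Im z > 0} = {z. Im z \<ge> 0}"
      using closure_halfspace_gt[of \<i> 0] by simp
    then have "k \<in> closure ({z. Im z > 0} - {k})" using k False by simp
    then show ?thesis by (simp add: at_within_eq_bot_iff)
  qed
  ultimately show ?thesis
    using False by (simp add: arg_krein_A_def tendsto_Lim)
qed

lemma krein_maximal_w_eq:
  "krein_maximal_w \<xi> A = (SUP x \<in> {0..}. ereal \<bar>Im (logv (of_real \<xi>) x)\<bar>)"
  unfolding krein_maximal_w_def by (intro SUP_cong refl) (simp add: arg_krein_A_eq)

lemma krein_maximal_w_le: "krein_maximal_w \<xi> A \<le> krein_maximal \<xi> A"
  unfolding krein_maximal_w_def
proof (rule SUP_least)
  fix x :: real assume "x \<in> {0..}"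
  then have x: "x \<ge> 0" by simp
  \<comment> \<open>Vertical approach: these points lie in the Stolz angle at \<open>\<xi>\<close>
    and tend to \<open>\<xi>\<close>.\<close>
  let ?k = "\<lambda>n. Complex \<xi> (1 / real (Suc n))"
  have lim: "?k \<longlonglongrightarrow> of_real \<xi>"
    by (rule tendsto_complex_iff[THEN iffD2]) (use LIMSEQ_inverse_real_of_nat in \<open>simp add: divide_inverse\<close>)
  have "(\<lambda>n. logv (?k n) x) \<longlonglongrightarrow> logv (of_real \<xi>) x"
    by (rule continuous_on_tendsto_compose[OF logv_continuous_in_k[OF x] lim]) auto
  then have lim2: "(\<lambda>n. ereal \<bar>Im (logv (?k n) x)\<bar>) \<longlonglongrightarrow> ereal \<bar>Im (logv (of_real \<xi>) x)\<bar>"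
    by (intro tendsto_intros)
  have bound: "ereal \<bar>Im (logv (?k n) x)\<bar> \<le> krein_maximal \<xi> A" for n
  proof -
    have "?k n \<in> stolz_angle \<xi>" by (simp add: stolz_angle_def)
    then have "ereal \<bar>arg_krein_A x (?k n) A\<bar> \<le> krein_maximal \<xi> A"
      unfolding krein_maximal_def using x by (intro SUP_upper2[of "(?k n, x)"]) auto
    then show ?thesis using arg_krein_A_eq[OF x, of "?k n"] by simp
  qed
  have "ereal \<bar>Im (logv (of_real \<xi>) x)\<bar> \<le> krein_maximal \<xi> A"
    by (rule LIMSEQ_le_const2[OF lim2]) (intro exI[of _ 0] allI impI bound)
  then show "ereal \<bar>arg_krein_A x (of_real \<xi>) A\<bar> \<le> krein_maximal \<xi> A"
    by (simp add: arg_krein_A_eq[OF x])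
qed

lemma krein_maximal_w_measurable: "{\<xi>. krein_maximal_w \<xi> A \<ge> ereal t} \<in> sets lebesgue"
proof (rule lower_semicontinuous_superlevel_measurable)
  fix s
  have "open {\<xi>. \<bar>Im (logv (of_real \<xi>) x)\<bar> > s}" if "x \<ge> 0" for x
    using continuous_on_real_line[OF logv_continuous_in_k[OF that]]
    by (intro open_Collect_less continuous_intros)
  moreover have "{\<xi>. krein_maximal_w \<xi> A > ereal s} = (\<Union>x\<in>{0..}. {\<xi>. \<bar>Im (logv (of_real \<xi>) x)\<bar> > s})"
    unfolding krein_maximal_w_eq less_SUP_iff by auto
  ultimately show "open {\<xi>. krein_maximal_w \<xi> A > ereal s}" by auto
qed

end

section \<open>Phase bounds from values in the right half-plane\<close>

text \<open>To leave the interval between \<open>- pi / 2\<close> and \<open>pi / 2\<close> the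
  angle would have to pass an endpoint, where the cosine vanishes. This converts information about
  an exponential into a bound for a continuous branch of its logarithm.\<close>

lemma cos_pos_angle_bound:
  fixes \<theta> :: "real \<Rightarrow> real"
  assumes "a \<le> b" "continuous_on {a..b} \<theta>" "\<theta> a = 0" "\<And>t. t \<in> {a..b} \<Longrightarrow> cos (\<theta> t) > 0"
  shows "\<bar>\<theta> b\<bar> < pi / 2"
proof (rule ccontr)
  assume "\<not> \<bar>\<theta> b\<bar> < pi / 2"
  then consider "\<theta> b \<ge> pi / 2" | "\<theta> b \<le> - (pi / 2)" by linarith
  then show False
  proof cases
    case 1
    then obtain t where t: "t \<in> {a..b}" "\<theta> t = pi / 2"
      using IVT'[of \<theta> a "pi / 2" b] assms by auto
    show False using assms(4)[OF t(1)] unfolding t(2) by simp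
  next
    case 2
    then obtain t where t: "t \<in> {a..b}" "\<theta> t = - (pi / 2)"
      using IVT2'[of \<theta> b "- (pi / 2)" a] assms by auto
    show False using assms(4)[OF t(1)] unfolding t(2) by simp
  qed
qed

lemma Re_quotient_pos:
  assumes "cmod (z - y) < cmod y"
  shows "Re (z / y) > 0"
proof -
  have y: "y \<noteq> 0" using assms by auto
  then have "z / y - 1 = (z - y) / y" by (simp add: diff_divide_distrib)
  then have "cmod (z / y - 1) < 1"
    using assms y by (simp add: norm_divide)
  then show ?thesis
    using abs_Re_le_cmod[of "z / y - 1"] by (simp del: one_complex.sel add: one_complex.sel(1))
qed

lemma cos_Im_pos_if_Re_exp_pos: "Re (exp z) > 0 \<Longrightarrow> cos (Im z) > 0"
  by (simp add: Re_exp zero_less_mult_iff)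

context krein_C1
begin

text \<open>The bound \<open>|v| \<ge> 1\<close> rules out winding around a limit 0. Once all values
  lie within 1/2 of the limit, they lie within 1 of \<open>v\<close> at \<open>a\<close>, so their
  quotients by it stay in the right half-plane and the phase moves by less than
  \<open>pi / 2\<close>; up to \<open>a\<close> it is bounded by compactness.\<close>

lemma krein_A_not_convergent:
  assumes unb: "\<And>M. \<exists>x\<ge>0. \<bar>Im (logv (of_real \<xi>) x)\<bar> > M"
  shows "\<not> (\<exists>l. ((\<lambda>x. krein_A x (of_real \<xi>) A) \<longlongrightarrow> l) at_top)"
proof
  let ?k = "complex_of_real \<xi>"
  assume "\<exists>l. ((\<lambda>x. krein_A x ?k A) \<longlongrightarrow> l) at_top"
  then obtain l where "((\<lambda>x. krein_A x ?k A) \<longlongrightarrow> l) at_top" by blast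
  then have "\<forall>\<^sub>F x in at_top. dist (krein_A x ?k A) l < 1 / 2"
    by (rule tendstoD) simp
  then obtain N where N: "\<And>x. x \<ge> N \<Longrightarrow> dist (krein_A x ?k A) l < 1 / 2"
    unfolding eventually_at_top_linorder by blast
  define a where "a = max N 0"
  have a: "a \<ge> 0" by (simp add: a_def)
  have near: "dist (v ?k x) l < 1 / 2" if "x \<ge> a" for x
    using N[of x] that by (simp add: a_def krein_A_eq)
  have "continuous_on {0..a} (\<lambda>x. \<bar>Im (logv ?k x)\<bar>)"
    by (intro continuous_intros continuous_on_subset[OF cont_logv]) auto
  then have "bounded ((\<lambda>x. \<bar>Im (logv ?k x)\<bar>) ` {0..a})"
    by (intro compact_imp_bounded compact_continuous_image) auto
  then obtain M where "\<forall>y\<in>(\<lambda>x. \<bar>Im (logv ?k x)\<bar>) ` {0..a}. norm y \<le> M"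
    unfolding bounded_iff by blast
  then have M: "\<bar>Im (logv ?k x)\<bar> \<le> M" if "x \<in> {0..a}" for x
    using that by auto
  have "\<bar>Im (logv ?k x)\<bar> \<le> M + pi / 2" if x: "x \<ge> 0" for x
  proof (cases "x \<le> a")
    case True
    then have "\<bar>Im (logv ?k x)\<bar> \<le> M" using M[of x] x by simp
    then show ?thesis using pi_gt_zero by linarith
  next
    case False
    have "\<bar>Im (logv ?k x) - Im (logv ?k a)\<bar> < pi / 2"
    proof (rule cos_pos_angle_bound[of a x "\<lambda>t. Im (logv ?k t) - Im (logv ?k a)"])
      show "continuous_on {a..x} (\<lambda>t. Im (logv ?k t) - Im (logv ?k a))"
        using a by (intro continuous_intros continuous_on_subset[OF cont_logv]) auto
      fix t assume t: "t \<in> {a..x}"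
      have "cmod (v ?k t - v ?k a) < 1"
        using dist_triangle_half_l[of "v ?k t" l 1 "v ?k a"] near[of t] near[of a] t by (simp add: dist_norm norm_minus_commute)
      also have "1 \<le> cmod (v ?k a)" using v_bounds(1)[of ?k a] a by simp
      finally have "cmod (v ?k t - v ?k a) < cmod (v ?k a)" .
      then have "Re (v ?k t / v ?k a) > 0" by (rule Re_quotient_pos)
      moreover have "exp (logv ?k t - logv ?k a) = v ?k t / v ?k a"
        using t a by (simp add: exp_diff exp_logv)
      ultimately have "Re (exp (logv ?k t - logv ?k a)) > 0" by simp
      then show "cos (Im (logv ?k t) - Im (logv ?k a)) > 0"
        using cos_Im_pos_if_Re_exp_pos by fastforce
    qed (use False in auto)
    moreover have "\<bar>Im (logv ?k a)\<bar> \<le> M" using M[of a] a by simp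
    ultimately show ?thesis by linarith
  qed
  with unb[of "M + pi / 2"] show False by (meson not_less)
qed

lemma krein_maximal_infinite:
  assumes unb: "\<And>M. \<exists>x\<ge>0. \<bar>Im (logv (of_real \<xi>) x)\<bar> > M"
  shows "krein_maximal_w \<xi> A = \<infinity>" "krein_maximal \<xi> A = \<infinity>"
proof -
  have "ereal M < krein_maximal_w \<xi> A" for M
    unfolding krein_maximal_w_eq less_SUP_iff using unb[of M] by auto
  then show 1: "krein_maximal_w \<xi> A = \<infinity>"
    by (metis ereal_less_eq(1) ereal_top less_imp_le)
  then show "krein_maximal \<xi> A = \<infinity>"
    using krein_maximal_w_le[of \<xi>] by simp
qed

section \<open>Restarting the system at a later time\<close>

text \<open>\<open>(U, V)\<close> is the second column of the transfer matrix from \<open>a\<close>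
  to \<open>x\<close>. For real \<open>k\<close> the first column of the fundamental matrix is
  \<open>exp (\<i> * k * x)\<close> times \<open>(cnj v, cnj u)\<close>, so the inverse at
  \<open>a\<close>, and with it \<open>U\<close> and \<open>V\<close>, is explicit in
  \<open>u\<close> and \<open>v\<close>; \<open>e\<close> is the quotient of the two exponentials.
  The formula for \<open>v k x\<close> is the lower right entry of transfer matrix times fundamental
  matrix at \<open>a\<close>.\<close>

lemma shifted_column:
  assumes a: "a \<ge> 0" and k: "Im k = 0"
  obtains U V e :: "real \<Rightarrow> complex"
  where "U a = 0" "V a = 1" "continuous_on {0..} U" "continuous_on {0..} V"
    "\<And>x. x > 0 \<Longrightarrow> (U has_vector_derivative \<i> * k * U x - cnj (A x) * V x) (at x)"
    "\<And>x. x > 0 \<Longrightarrow> (V has_vector_derivative - A x * U x) (at x)"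
    "\<And>x. x \<ge> 0 \<Longrightarrow> (cmod (V x))\<^sup>2 - (cmod (U x))\<^sup>2 = 1"
    "\<And>x. x \<ge> 0 \<Longrightarrow> v k x = V x * v k a + e x * cnj (U x) * u k a"
    "\<And>x. cmod (e x) = 1"
proof -
  define e where "e x = exp (\<i> * k * (of_real x - of_real a))" for x
  define U where "U x = u k x * cnj (v k a) - e x * cnj (v k x) * u k a" for x
  define V where "V x = v k x * cnj (v k a) - e x * cnj (u k x) * u k a" for x
  have kr: "cnj k = k" using k by (simp add: complex_eq_iff)
  have one: "v k x * cnj (v k x) - u k x * cnj (u k x) = 1" if "x \<ge> 0" for x
    using pseudo_norm_eq_1[OF k that] by (simp add: complex_norm_square[symmetric] flip: of_real_diff of_real_power)
  have i: "U a = 0" "V a = 1"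
    using one[OF a] by (simp_all add: U_def V_def e_def mult.commute)
  have ce: "continuous_on S e" for S unfolding e_def[abs_def] by (intro continuous_intros)
  have c: "continuous_on {0..} U" "continuous_on {0..} V"
    unfolding U_def[abs_def] V_def[abs_def] by (intro continuous_intros ce cont_uv)+
  have de: "(e has_vector_derivative \<i> * k * e x) (at x)" for x
  proof -
    have "((\<lambda>x. \<i> * k * (of_real x - of_real a)) has_vector_derivative \<i> * k * (1 - 0)) (at x)"
      using has_vector_derivative_of_real[OF DERIV_ident, where 'a = complex and F = "at x"]
      by (intro has_vector_derivative_mult_right has_vector_derivative_diff has_vector_derivative_const) simp
    from has_vector_derivative_exp[OF this] show ?thesis by (simp add: e_def[abs_def])
  qed
  have dU: "(U has_vector_derivative \<i> * k * U x - cnj (A x) * V x) (at x)" if "x > 0" for x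
  proof -
    have "(U has_vector_derivative
      (\<i> * k * u k x - cnj (A x) * v k x) * cnj (v k a) -
        (e x * cnj (- A x * u k x) + \<i> * k * e x * cnj (v k x)) * u k a) (at x)"
      unfolding U_def[abs_def]
      by (intro has_vector_derivative_diff has_vector_derivative_mult_left has_vector_derivative_mult
          has_vector_derivative_cnj de deriv_u deriv_v that)
    then show ?thesis by (simp add: U_def V_def algebra_simps)
  qed
  have dV: "(V has_vector_derivative - A x * U x) (at x)" if "x > 0" for x
  proof -
    have "(V has_vector_derivative
      (- A x * u k x) * cnj (v k a) -
        (e x * cnj (\<i> * k * u k x - cnj (A x) * v k x) + \<i> * k * e x * cnj (u k x)) * u k a) (at x)"
      unfolding V_def[abs_def]
      by (intro has_vector_derivative_diff has_vector_derivative_mult_left has_vector_derivative_mult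
          has_vector_derivative_cnj de deriv_u deriv_v that)
    then show ?thesis by (simp add: U_def V_def algebra_simps kr)
  qed
  have "\<i> * k * (complex_of_real x - complex_of_real a) = \<i> * of_real (Re k * (x - a))" for x
    using k by (simp add: complex_eq_iff)
  then have ne: "cmod (e x) = 1" for x
    by (simp only: e_def norm_exp_i_times)
  then have ee: "e x * cnj (e x) = 1" for x
    by (simp add: complex_norm_square[symmetric])
  have VV: "V x * cnj (V x) - U x * cnj (U x) = 1" if x: "x \<ge> 0" for x
  proof -
    have "V x * cnj (V x) - U x * cnj (U x) =
      (v k x * cnj (v k x) - u k x * cnj (u k x)) * (v k a * cnj (v k a))
       - (e x * cnj (e x)) * (v k x * cnj (v k x) - u k x * cnj (u k x)) * (u k a * cnj (u k a))"
      unfolding U_def V_def by (simp add: algebra_simps)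
    also have "\<dots> = 1" using one[OF x] one[OF a] ee[of x] by simp
    finally show ?thesis .
  qed
  then have p: "(cmod (V x))\<^sup>2 - (cmod (U x))\<^sup>2 = 1" if "x \<ge> 0" for x
    using VV[OF that] by (simp add: complex_norm_square[symmetric] flip: of_real_diff of_real_power)
  have vV: "v k x = V x * v k a + e x * cnj (U x) * u k a" if "x \<ge> 0" for x
  proof -
    have "V x * v k a + e x * cnj (U x) * u k a =
       v k x * (v k a * cnj (v k a) - (e x * cnj (e x)) * (u k a * cnj (u k a)))"
      unfolding U_def V_def by (simp add: algebra_simps)
    also have "\<dots> = v k x" using one[OF a] ee[of x] by simp
    finally show ?thesis by simp
  qed
  show ?thesis by (rule that[OF i c dU dV p vV ne])
qed

text \<open>Restarting the system at \<open>a\<close> with trivial reflection coefficient costs less than a right angle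
  of phase: \<open>v x / (V x v a)\<close> lies in the disc of radius 1 around 1. Hence no bound on \<open>r\<close> at the
  beginning of a sweep is needed.\<close>

lemma shifted_phase:
  fixes \<xi> a :: real
  assumes a: "a \<ge> 0"
  obtains W \<Theta> where
    "continuous_on {0..} W" "continuous_on {0..} \<Theta>" "W a = 0" "\<And>x. x \<ge> 0 \<Longrightarrow> cmod (W x) < 1"
    "\<And>x. x > 0 \<Longrightarrow> (W has_vector_derivative \<i> * of_real \<xi> * W x - cnj (A x) + A x * (W x)\<^sup>2) (at x)"
    "\<And>x. x > 0 \<Longrightarrow> (\<Theta> has_real_derivative - Im (A x * W x)) (at x)"
    "\<And>x. x \<ge> a \<Longrightarrow> \<bar>Im (logv (of_real \<xi>) x) - Im (logv (of_real \<xi>) a) - (\<Theta> x - \<Theta> a)\<bar> < pi / 2"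
proof -
  define k where "k = complex_of_real \<xi>"
  have k: "Im k = 0" by (simp add: k_def)
  obtain U V e where sc: "U a = 0" "V a = 1" "continuous_on {0..} U" "continuous_on {0..} V"
    "\<And>x. x > 0 \<Longrightarrow> (U has_vector_derivative \<i> * k * U x - cnj (A x) * V x) (at x)"
    "\<And>x. x > 0 \<Longrightarrow> (V has_vector_derivative - A x * U x) (at x)"
    "\<And>x. x \<ge> 0 \<Longrightarrow> (cmod (V x))\<^sup>2 - (cmod (U x))\<^sup>2 = 1"
    "\<And>x. x \<ge> 0 \<Longrightarrow> v k x = V x * v k a + e x * cnj (U x) * u k a"
    "\<And>x. cmod (e x) = 1"
    by (rule shifted_column[OF a k]) blast
  have less: "cmod (U x) < cmod (V x)" if "x \<ge> 0" for x
  proof (rule power2_less_imp_less)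
    show "(cmod (U x))\<^sup>2 < (cmod (V x))\<^sup>2" using sc(7)[OF that] by linarith
  qed simp
  have V: "V x \<noteq> 0" if "x \<ge> 0" for x using less[OF that] by auto
  define W where "W x = U x / V x" for x
  \<comment> \<open>The integral starts at 0 while \<open>V\<close> equals 1 at \<open>a\<close>, so
    the logarithm of \<open>V\<close> is \<open>L x - L a\<close>.\<close>
  define L where "L x = - integral {0..x} (\<lambda>t. A t * W t)" for x
  have cW: "continuous_on {0..} W"
    unfolding W_def[abs_def] using V by (intro continuous_intros sc) auto
  have dW: "(W has_vector_derivative \<i> * k * W x - cnj (A x) + A x * (W x)\<^sup>2) (at x)" if x: "x > 0" for x
    unfolding W_def by (rule riccati_derivative[OF sc(5,6)[OF x]]) (use V x in auto)
  have W1: "cmod (W x) < 1" if "x \<ge> 0" for x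
    using less[OF that] V[OF that] by (simp add: W_def norm_divide divide_less_eq_1)
  have cL: "continuous_on {0..} L"
    unfolding L_def[abs_def] by (intro continuous_on_minus continuous_on_integral_upto continuous_on_mult contA cW)
  have dL: "(L has_vector_derivative - (A x * W x)) (at x)" if "x > 0" for x
    unfolding L_def[abs_def]
    by (intro has_vector_derivative_minus has_vector_derivative_integral_upto continuous_on_mult contA cW that)
  have VL: "V x = exp (L x - L a)" if x: "x \<ge> a" for x
  proof -
    have "V x * exp (- L x) = V a * exp (- L a)"
    proof (rule constant_on_if_has_vector_derivative_0[OF x])
      show "continuous_on {a..x} (\<lambda>x. V x * exp (- L x))"
        by (intro continuous_intros continuous_on_subset[OF cL] continuous_on_subset[OF sc(4)]) (use a in auto)
      fix t assume t: "a < t" "t < x"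
      then have t0: "t > 0" using a by simp
      have "((\<lambda>x. V x * exp (- L x)) has_vector_derivative
        V t * (- (- (A t * W t)) * exp (- L t)) + (- A t * U t) * exp (- L t)) (at t)"
        by (intro has_vector_derivative_mult has_vector_derivative_exp has_vector_derivative_minus
            dL sc(6) t0)
      then show "((\<lambda>x. V x * exp (- L x)) has_vector_derivative 0) (at t)"
        using V[of t] t0 by (simp add: W_def)
    qed
    then show ?thesis by (simp add: sc(2) exp_minus exp_diff field_simps)
  qed
  have close: "\<bar>Im (logv k x) - Im (logv k a) - (Im (L x) - Im (L a))\<bar> < pi / 2" if x: "x \<ge> a" for x
  proof (rule cos_pos_angle_bound[OF x, of "\<lambda>x. Im (logv k x) - Im (logv k a) - (Im (L x) - Im (L a))"])
    show "continuous_on {a..x} (\<lambda>x. Im (logv k x) - Im (logv k a) - (Im (L x) - Im (L a)))"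
      by (intro continuous_intros continuous_on_subset[OF cL] continuous_on_subset[OF cont_logv])
         (use a k in auto)
    fix t assume "t \<in> {a..x}"
    then have t: "t \<ge> a" "t \<ge> 0" using a by auto
    have va: "v k a \<noteq> 0" using v_bounds(2)[of k a] a k by simp
    have "cmod (u k a) \<le> cmod (v k a)"
      using v_bounds(3)[of k a] va a k by (simp add: schur_def norm_divide divide_le_eq_1)
    then have "cmod (U t) * cmod (u k a) \<le> cmod (U t) * cmod (v k a)"
      by (intro mult_left_mono) auto
    also have "\<dots> < cmod (V t) * cmod (v k a)"
      using less[OF t(2)] va by (intro mult_strict_right_mono) auto
    finally have "cmod (e t * cnj (U t) * u k a) < cmod (V t * v k a)"
      by (simp add: norm_mult sc(9))
    then have "Re (v k t / (V t * v k a)) > 0"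
      by (intro Re_quotient_pos) (simp add: sc(8)[OF t(2)])
    moreover have "exp (logv k t - logv k a - (L t - L a)) = v k t / (V t * v k a)"
      using VL[OF t(1)] t a k by (simp add: exp_diff exp_logv)
    ultimately have "Re (exp (logv k t - logv k a - (L t - L a))) > 0" by simp
    then show "cos (Im (logv k t) - Im (logv k a) - (Im (L t) - Im (L a))) > 0"
      using cos_Im_pos_if_Re_exp_pos by fastforce
  qed simp
  show ?thesis
  proof (rule that[of W "\<lambda>x. Im (L x)"])
    show "((\<lambda>x. Im (L x)) has_real_derivative - Im (A x * W x)) (at x)" if "x > 0" for x
      using has_real_derivative_Re_Im(2)[OF dL[OF that]] by simp
  qed (use cW cL dW W1 close sc(1) in \<open>auto intro!: continuous_intros simp: k_def W_def\<close>)
qed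

end

section \<open>The chirped coefficient\<close>

text \<open>With angle \<open>\<theta>\<close> one has \<open>\<theta>' = exp (1 - exp \<theta> - \<theta>)\<close>, so \<open>ln (1 / c)\<close> is of order \<open>exp \<theta>\<close> and beats the
  factor \<open>c\<^sup>2 / \<theta>' = \<delta>\<^sup>2 exp (- \<theta> / 2)\<close> that makes \<open>c\<close> square integrable.\<close>

definition chirp_angle :: "real \<Rightarrow> real" where
  "chirp_angle x = ln (1 + ln (1 + x))"

text \<open>The frequency oscillates over \<open>[0, 3]\<close>, so a point \<open>\<xi>\<close> of
  \<open>[1, 2]\<close> is at distance at least 1 when an upward sweep begins and is met before the
  sweep ends.\<close>

definition chirp_freq :: "real \<Rightarrow> real" where
  "chirp_freq x = 3 / 2 * (1 - cos (chirp_angle x))"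

definition chirp_phase :: "real \<Rightarrow> real" where
  "chirp_phase x = integral {0..x} chirp_freq"

text \<open>The exponents come from prescribing
  \<open>c^2 = \<delta>^2 * exp (- \<theta> / 2) * \<theta>'\<close> with
  \<open>\<theta>' = exp (- ln (1 + x) - \<theta>)\<close>, which makes the square an exact
  derivative.\<close>

definition chirp_ampl :: "real \<Rightarrow> real \<Rightarrow> real" where
  "chirp_ampl \<delta> x = \<delta> * exp (- ln (1 + x) / 2 - 3 / 4 * chirp_angle x)"

definition chirp :: "real \<Rightarrow> real \<Rightarrow> complex" where
  "chirp \<delta> x = of_real (chirp_ampl \<delta> x) * exp (- \<i> * of_real (chirp_phase x))"

definition chirp_angle' :: "real \<Rightarrow> real" where
  "chirp_angle' x = exp (- ln (1 + x) - chirp_angle x)"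

definition chirp_ampl' :: "real \<Rightarrow> real \<Rightarrow> real" where
  "chirp_ampl' \<delta> x = chirp_ampl \<delta> x * (- (1 / (1 + x)) / 2 - 3 / 4 * chirp_angle' x)"

lemma ln_ge_0: "x \<ge> 0 \<Longrightarrow> 1 + ln (1 + x) > (0 :: real)"
  by (simp add: add_pos_nonneg)

lemma deriv_chirp_angle:
  assumes "x \<ge> 0" shows "(chirp_angle has_real_derivative chirp_angle' x) (at x)"
proof -
  have "(chirp_angle has_real_derivative 1 / (1 + x) / (1 + ln (1 + x))) (at x)"
    unfolding chirp_angle_def[abs_def] using ln_ge_0[OF assms] assms
    by (auto intro!: derivative_eq_intros)
  also have "1 / (1 + x) / (1 + ln (1 + x)) = chirp_angle' x"
    using ln_ge_0[OF assms] assms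
    by (simp add: chirp_angle'_def chirp_angle_def exp_diff exp_minus divide_inverse)
  finally show ?thesis .
qed

lemma continuous_chirp:
  "continuous_on {0..} chirp_angle" "continuous_on {0..} chirp_freq" "continuous_on {0..} (chirp_ampl \<delta>)"
  "continuous_on {0..} chirp_angle'" "continuous_on {0..} (chirp_ampl' \<delta>)" "continuous_on {0..} chirp_phase"
  "continuous_on {0..} (chirp \<delta>)"
proof -
  have ln: "continuous_on {0..} (\<lambda>x::real. ln (1 + x))"
    by (intro continuous_intros) auto
  have pos: "1 + ln (1 + x) \<noteq> 0" if "x \<in> {0..}" for x :: real using ln_ge_0[of x] that by simp
  show th: "continuous_on {0..} chirp_angle"
    unfolding chirp_angle_def[abs_def] using pos by (intro continuous_intros ln) auto
  show freq: "continuous_on {0..} chirp_freq"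
    unfolding chirp_freq_def[abs_def] by (intro continuous_intros th)
  show ampl: "continuous_on {0..} (chirp_ampl \<delta>)"
    unfolding chirp_ampl_def[abs_def] by (intro continuous_intros th ln) auto
  show th': "continuous_on {0..} chirp_angle'"
    unfolding chirp_angle'_def[abs_def] by (intro continuous_intros th ln)
  show "continuous_on {0..} (chirp_ampl' \<delta>)"
    unfolding chirp_ampl'_def[abs_def] by (intro continuous_intros ampl th') auto
  show phase: "continuous_on {0..} chirp_phase"
    unfolding chirp_phase_def[abs_def] by (rule continuous_on_integral_upto[OF freq])
  show "continuous_on {0..} (chirp \<delta>)"
    unfolding chirp_def[abs_def] by (intro continuous_intros ampl phase)
qed

lemma deriv_chirp_ampl:
  assumes "x \<ge> 0" shows "(chirp_ampl \<delta> has_real_derivative chirp_ampl' \<delta> x) (at x)"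
  unfolding chirp_ampl_def[abs_def] chirp_ampl'_def
  using assms by (auto intro!: derivative_eq_intros deriv_chirp_angle simp: field_simps)

lemma deriv_chirp_phase:
  assumes "x > 0" shows "(chirp_phase has_vector_derivative chirp_freq x) (at x)"
  unfolding chirp_phase_def[abs_def]
  by (rule has_vector_derivative_integral_upto[OF continuous_chirp(2) assms])

lemma deriv_exp_chirp_phase:
  fixes z :: complex
  assumes "x > 0"
  shows "((\<lambda>x. exp (z * of_real (chirp_phase x))) has_vector_derivative
      z * of_real (chirp_freq x) * exp (z * of_real (chirp_phase x))) (at x)"
  by (intro has_vector_derivative_exp has_vector_derivative_mult_right has_vector_derivative_of_real)
     (simp add: has_real_derivative_iff_has_vector_derivative deriv_chirp_phase[OF assms])

lemma deriv_chirp: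
  assumes "x > 0"
  shows "(chirp \<delta> has_vector_derivative
     (of_real (chirp_ampl' \<delta> x) - \<i> * of_real (chirp_ampl \<delta> x * chirp_freq x)) * exp (- \<i> * of_real (chirp_phase x))) (at x)"
proof -
  have "(chirp \<delta> has_vector_derivative
     of_real (chirp_ampl \<delta> x) * (- \<i> * of_real (chirp_freq x) * exp (- \<i> * of_real (chirp_phase x)))
      + of_real (chirp_ampl' \<delta> x) * exp (- \<i> * of_real (chirp_phase x))) (at x)"
    unfolding chirp_def[abs_def] using assms
    by (intro has_vector_derivative_mult deriv_exp_chirp_phase has_vector_derivative_of_real deriv_chirp_ampl) auto
  then show ?thesis by (simp add: algebra_simps)
qed

lemma cmod_chirp: "\<delta> \<ge> 0 \<Longrightarrow> cmod (chirp \<delta> x) = chirp_ampl \<delta> x"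
  by (simp add: chirp_def norm_mult chirp_ampl_def)

lemma chirp_ampl_squared:
  "(chirp_ampl \<delta> x)\<^sup>2 = \<delta>\<^sup>2 * exp (- chirp_angle x / 2) * chirp_angle' x"
  by (simp add: chirp_ampl_def chirp_angle'_def power_mult_distrib power2_eq_square[of "exp _"] flip: exp_add)

lemma chirp_angle_tendsto: "filterlim chirp_angle at_top at_top"
  unfolding chirp_angle_def[abs_def] by real_asymp

lemma chirp_L2:
  assumes "\<delta> \<ge> 0"
  shows "chirp \<delta> \<in> L2_half_line" and "L2_half_line_norm (chirp \<delta>) = sqrt 2 * \<delta>"
proof -
  \<comment> \<open>\<open>?F\<close> is the primitive of the squared amplitude. It tends to 0 at
    infinity and equals \<open>- 2 * \<delta>^2\<close> at 0, where the angle vanishes; hence the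
    norm \<open>sqrt 2 * \<delta>\<close>.\<close>
  let ?f = "\<lambda>x. (chirp_ampl \<delta> x)\<^sup>2" and ?F = "\<lambda>x. - 2 * \<delta>\<^sup>2 * exp (- chirp_angle x / 2)"
  have "chirp_angle \<in> borel_measurable borel" unfolding chirp_angle_def[abs_def] by measurable
  then have fm [measurable]: "?f \<in> borel_measurable borel"
    unfolding chirp_ampl_def[abs_def] by measurable
  have "(\<integral>\<^sup>+x. ennreal (?f x) * indicator {0..} x \<partial>lborel) = ennreal (0 - ?F 0)"
  proof (rule nn_integral_FTC_atLeast[OF fm])
    show "DERIV ?F x :> ?f x" if "0 \<le> x" for x
      unfolding chirp_ampl_squared
      by (auto intro!: derivative_eq_intros deriv_chirp_angle that)
    have "((\<lambda>x. - 2 * \<delta>\<^sup>2 * exp (- chirp_angle x / 2)) \<longlongrightarrow> - 2 * \<delta>\<^sup>2 * 0) at_top"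
      by (intro tendsto_intros filterlim_compose[OF exp_at_bot]
          filterlim_compose[OF _ chirp_angle_tendsto, of "\<lambda>y. - y / 2"]) real_asymp
    then show "(?F \<longlongrightarrow> 0) at_top" by simp
  qed simp
  moreover have "ennreal (?f x) * indicator {0..} x = ennreal (indicator {0..} x *\<^sub>R ?f x)" for x
    by (simp split: split_indicator)
  ultimately have "(\<integral>\<^sup>+x. ennreal (indicator {0..} x *\<^sub>R ?f x) \<partial>lborel) = ennreal (2 * \<delta>\<^sup>2)"
    by (simp add: chirp_angle_def)
  then have "has_bochner_integral lborel (\<lambda>x. indicator {0..} x *\<^sub>R ?f x) (2 * \<delta>\<^sup>2)"
    by (intro has_bochner_integral_nn_integral) auto
  then have "integrable lebesgue (\<lambda>x. indicator {0..} x *\<^sub>R ?f x)" "(LINT x|lebesgue. indicator {0..} x *\<^sub>R ?f x) = 2 * \<delta>\<^sup>2"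
    by (simp_all add: integrable_completion integral_completion has_bochner_integral_iff)
  then have int: "integrable (lebesgue_on {0..}) ?f" "(LINT x|lebesgue_on {0..}. ?f x) = 2 * \<delta>\<^sup>2"
    by (simp_all add: integrable_restrict_space integral_restrict_space)
  have "chirp \<delta> \<in> borel_measurable (lebesgue_on {0..})"
    by (rule continuous_imp_measurable_on_sets_lebesgue[OF continuous_chirp(7)]) simp
  then show "chirp \<delta> \<in> L2_half_line"
    using int by (simp add: L2_half_line_def cmod_chirp[OF assms])
  show "L2_half_line_norm (chirp \<delta>) = sqrt 2 * \<delta>"
    using int assms by (simp add: L2_half_line_norm_def cmod_chirp[OF assms] real_sqrt_mult)
qed

lemma krein_C1_chirp:
  obtains u v where "krein_C1 (chirp \<delta>)
     (\<lambda>x. (of_real (chirp_ampl' \<delta> x) - \<i> * of_real (chirp_ampl \<delta> x * chirp_freq x)) * exp (- \<i> * of_real (chirp_phase x))) u v"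
proof -
  obtain u v where uv: "\<And>k. krein_column (chirp \<delta>) k 0 1 (u k) (v k)"
    "\<And>k x. x \<ge> 0 \<Longrightarrow> krein_A x k (chirp \<delta>) = v k x"
    "\<And>x. x \<ge> 0 \<Longrightarrow> (\<lambda>k. u k x) holomorphic_on UNIV" "\<And>x. x \<ge> 0 \<Longrightarrow> (\<lambda>k. v k x) holomorphic_on UNIV"
    by (rule krein_X_column[OF continuous_chirp(7)]) blast
  show ?thesis
  proof (rule that[of u v], unfold_locales)
    show "continuous_on {0..} (\<lambda>x. (complex_of_real (chirp_ampl' \<delta> x) - \<i> * complex_of_real (chirp_ampl \<delta> x * chirp_freq x))
        * exp (- \<i> * complex_of_real (chirp_phase x)))"
      by (intro continuous_intros continuous_chirp)
  qed (use uv continuous_chirp(7) deriv_chirp in auto)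
qed

section \<open>Phase gain over one sweep\<close>

text \<open>The inverse of \<open>chirp_angle\<close>. The upward sweep with number \<open>m\<close>
  starts at \<open>chirp_time (2 * pi * m)\<close> and ends at
  \<open>chirp_time (2 * pi * m + pi)\<close>.\<close>

definition chirp_time :: "real \<Rightarrow> real" where
  "chirp_time y = exp (exp y - 1) - 1"

lemma chirp_angle_time [simp]: "chirp_angle (chirp_time y) = y"
  by (simp add: chirp_angle_def chirp_time_def)

lemma chirp_time_nonneg: "y \<ge> 0 \<Longrightarrow> chirp_time y \<ge> 0"
  by (simp add: chirp_time_def)

lemma chirp_time_mono: "y \<le> z \<Longrightarrow> chirp_time y \<le> chirp_time z"
  by (simp add: chirp_time_def)

lemma chirp_angle_mono: "0 \<le> x \<Longrightarrow> x \<le> y \<Longrightarrow> chirp_angle x \<le> chirp_angle y"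
  unfolding chirp_angle_def using ln_ge_0[of x] by (intro ln_mono add_left_mono) auto

lemma deriv_chirp_freq:
  assumes "x \<ge> 0" shows "(chirp_freq has_real_derivative 3 / 2 * sin (chirp_angle x) * chirp_angle' x) (at x)"
  unfolding chirp_freq_def[abs_def] by (auto intro!: derivative_eq_intros deriv_chirp_angle assms)

context
  fixes \<delta> :: real and A' u v
  assumes \<delta>: "\<delta> > 0" and kc: "krein_C1 (chirp \<delta>) A' u v"
begin

interpretation krein_C1 "chirp \<delta>" A' u v by (rule kc)

text \<open>The distance \<open>D\<close> from the resonance at which sweep \<open>m\<close> is
  abandoned, taken with equality in \<open>8 * c a \<le> D\<close>.\<close>

definition chirp_gap :: "nat \<Rightarrow> real" where
  "chirp_gap m = 8 * chirp_ampl \<delta> (chirp_time (2 * pi * m))"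

text \<open>The \<open>\<kappa>\<close> of the resonance estimate: \<open>- s'\<close> is at most
  \<open>3 / 2 * \<theta>'\<close>, and \<open>exp (- \<theta> / 2)\<close> is smallest at the end
  of the upward sweep, where \<open>\<theta> = 2 * pi * m + pi\<close>.\<close>

definition chirp_rate :: "nat \<Rightarrow> real" where
  "chirp_rate m = 2 / 3 * \<delta>\<^sup>2 * exp (- (pi * m) - pi / 2)"

text \<open>The detuning runs from \<open>\<xi> \<ge> 1\<close> down to \<open>D\<close>, which
  yields a logarithm of at least \<open>ln (1 / D)\<close>. The loss of 1 comes from the boundary
  terms of the resonance estimate, the loss of \<open>pi / 2\<close> from the restart at the
  beginning of the sweep.\<close>

lemma sweep_growth:
  assumes \<xi>: "\<xi> \<in> {1..2}" and m: "chirp_gap m < 1"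
  shows "\<exists>x\<ge>0. \<exists>y\<ge>0. Im (logv (of_real \<xi>) y) - Im (logv (of_real \<xi>) x) \<ge> chirp_rate m / 15 * ln (1 / chirp_gap m) - 1 - pi / 2"
proof -
  define a where "a = chirp_time (2 * pi * m)"
  define d where "d = chirp_time (2 * pi * m + pi)"
  define D where "D = chirp_gap m"
  have ad: "0 \<le> a" "a \<le> d"
    by (simp_all add: a_def d_def chirp_time_nonneg chirp_time_mono)
  have D: "D > 0" "D < 1" "8 * chirp_ampl \<delta> a = D"
    using m \<delta> by (simp_all add: D_def chirp_gap_def a_def chirp_ampl_def)
  have period: "cos (2 * pi * m) = 1" "sin (2 * pi * m) = 0"
    using cos_2npi[of m] sin_2npi[of m] by (simp_all add: mult_ac)
  have freq_a: "chirp_freq a = 0" and freq_d: "chirp_freq d = 3"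
    using period by (simp_all add: a_def d_def chirp_freq_def)
  have th: "2 * pi * m \<le> chirp_angle t" "chirp_angle t \<le> 2 * pi * m + pi" if "t \<in> {a..d}" for t
    using chirp_angle_mono[of a t] chirp_angle_mono[of t d] that ad by (simp_all add: a_def d_def)
  have sin: "sin (chirp_angle t) \<ge> 0" if "t \<in> {a..d}" for t
  proof -
    have "sin (chirp_angle t) = sin (chirp_angle t - 2 * pi * m)"
      unfolding sin_diff period by simp
    then show ?thesis using th[OF that] by (simp add: sin_ge_zero)
  qed
  have freq_mono: "chirp_freq x \<le> chirp_freq y" if "a \<le> x" "x \<le> y" "y \<le> d" for x y
  proof (rule DERIV_nonneg_imp_nondecreasing[OF that(2)])
    fix t assume "x \<le> t" "t \<le> y"
    then have "t \<in> {a..d}" "t \<ge> 0" using that ad by auto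
    then show "\<exists>z. (chirp_freq has_real_derivative z) (at t) \<and> 0 \<le> z"
      using sin[of t]
      by (intro exI[of _ "3 / 2 * sin (chirp_angle t) * chirp_angle' t"] conjI deriv_chirp_freq)
         (auto simp: chirp_angle'_def)
  qed
  have "continuous_on {a..d} chirp_freq"
    by (rule continuous_on_subset[OF continuous_chirp(2)]) (use ad in auto)
  \<comment> \<open>The value \<open>\<xi> - D\<close> lies in \<open>[0, 3]\<close> because
    \<open>D < 1 \<le> \<xi>\<close>. Monotonicity of the frequency keeps the detuning at least
    \<open>D\<close> up to this time.\<close>
  then obtain b where b: "a \<le> b" "b \<le> d" "chirp_freq b = \<xi> - D"
    using IVT'[of chirp_freq a "\<xi> - D" d] ad \<xi> D freq_a freq_d by auto
  obtain W \<Theta> where W: "continuous_on {0..} W" "continuous_on {0..} \<Theta>" "W a = 0" "\<And>x. x \<ge> 0 \<Longrightarrow> cmod (W x) < 1"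
    and dW: "\<And>x. x > 0 \<Longrightarrow> (W has_vector_derivative \<i> * of_real \<xi> * W x - cnj (chirp \<delta> x) + chirp \<delta> x * (W x)\<^sup>2) (at x)"
    and d\<Theta>: "\<And>x. x > 0 \<Longrightarrow> (\<Theta> has_real_derivative - Im (chirp \<delta> x * W x)) (at x)"
    and close: "\<And>x. x \<ge> a \<Longrightarrow> \<bar>Im (logv (of_real \<xi>) x) - Im (logv (of_real \<xi>) a) - (\<Theta> x - \<Theta> a)\<bar> < pi / 2"
    by (rule shifted_phase[OF ad(1), of \<xi>]) blast
  define ex where "ex x = exp (- \<i> * of_real (chirp_phase x))" for x
  have ex1: "ex x * cnj (ex x) = 1" "cmod (ex x) = 1" for x
    by (simp_all add: ex_def exp_cnj flip: exp_add)
  have A: "chirp \<delta> x = of_real (chirp_ampl \<delta> x) * ex x" for x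
    by (simp add: chirp_def ex_def)
  define w where "w x = ex x * W x" for x
  define s where "s x = \<xi> - chirp_freq x" for x
  define s' where "s' x = - (3 / 2 * sin (chirp_angle x) * chirp_angle' x)" for x
  have res: "resonance w (chirp_ampl \<delta>) (chirp_ampl' \<delta>) s s' \<Theta> a b D (chirp_rate m)"
  proof unfold_locales
    have sub: "{a..b} \<subseteq> {0..}" using ad by auto
    show "continuous_on {a..b} w" unfolding w_def[abs_def] ex_def
      by (intro continuous_intros continuous_on_subset[OF continuous_chirp(6) sub] continuous_on_subset[OF W(1) sub])
    show "continuous_on {a..b} (chirp_ampl \<delta>)" by (rule continuous_on_subset[OF continuous_chirp(3) sub])
    show "continuous_on {a..b} s" unfolding s_def[abs_def]
      by (intro continuous_intros continuous_on_subset[OF continuous_chirp(2) sub])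
    show "continuous_on {a..b} \<Theta>" by (rule continuous_on_subset[OF W(2) sub])
    show "chirp_rate m \<ge> 0" by (simp add: chirp_rate_def)
    show "w a = 0" by (simp add: w_def W)
    show "a \<le> b" "D > 0" "8 * chirp_ampl \<delta> a \<le> D" using b D by auto
    fix t assume "t \<in> {a..b}"
    then have t: "t \<in> {a..b}" "t \<in> {a..d}" "t \<ge> 0" using b ad by auto
    show "chirp_ampl \<delta> t \<ge> 0" using \<delta> by (simp add: chirp_ampl_def)
    show "s t \<ge> D" using freq_mono[of t b] t b by (simp add: s_def)
    show "cmod (w t) < 1" using W(4)[OF t(3)] by (simp add: w_def norm_mult ex1)
  next
    fix t assume tt: "a < t" "t < b"
    then have t: "t > 0" "t \<in> {a..d}" using ad b by auto
    then have t0: "t \<ge> 0" by simp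
    have th': "chirp_angle' t \<ge> 0" by (simp add: chirp_angle'_def)
    have "(w has_vector_derivative ex t * (\<i> * of_real \<xi> * W t - cnj (chirp \<delta> t) + chirp \<delta> t * (W t)\<^sup>2)
        + (- \<i> * of_real (chirp_freq t) * ex t) * W t) (at t)"
      unfolding w_def[abs_def] ex_def by (intro has_vector_derivative_mult deriv_exp_chirp_phase dW t)
    moreover have "ex t * (\<i> * of_real \<xi> * W t - cnj (chirp \<delta> t) + chirp \<delta> t * (W t)\<^sup>2)
        + (- \<i> * of_real (chirp_freq t) * ex t) * W t =
        \<i> * of_real (s t) * w t - of_real (chirp_ampl \<delta> t) * (ex t * cnj (ex t) - (w t)\<^sup>2)"
      by (simp add: A w_def s_def power2_eq_square algebra_simps)
    ultimately show "(w has_vector_derivative \<i> * of_real (s t) * w t - of_real (chirp_ampl \<delta> t) * (1 - (w t)\<^sup>2)) (at t)"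
      by (simp only: ex1)
    show "(chirp_ampl \<delta> has_real_derivative chirp_ampl' \<delta> t) (at t)" by (rule deriv_chirp_ampl[OF t0])
    show "(s has_real_derivative s' t) (at t)"
      unfolding s_def[abs_def] s'_def by (auto intro!: derivative_eq_intros deriv_chirp_freq t0)
    show "(\<Theta> has_real_derivative - chirp_ampl \<delta> t * Im (w t)) (at t)"
      using d\<Theta>[OF t(1)] by (simp add: A w_def mult.assoc)
    have "chirp_ampl \<delta> t \<ge> 0" using \<delta> by (simp add: chirp_ampl_def)
    moreover have "1 / (1 + t) \<ge> 0" using t0 by simp
    have "- (p / 2) - 3 / 4 * q \<le> 0" if "p \<ge> 0" "q \<ge> 0" for p q :: real
      using that by simp
    from this[OF \<open>1 / (1 + t) \<ge> 0\<close> th'] have "- (1 / (1 + t)) / 2 - 3 / 4 * chirp_angle' t \<le> 0"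
      unfolding minus_divide_left .
    ultimately show "chirp_ampl' \<delta> t \<le> 0"
      unfolding chirp_ampl'_def by (rule mult_nonneg_nonpos)
    show "s' t \<le> 0" using sin[OF t(2)] th' by (simp add: s'_def)
    show "chirp_rate m * (- s' t) \<le> (chirp_ampl \<delta> t)\<^sup>2"
    proof -
      have "chirp_rate m * (- s' t) \<le> chirp_rate m * (3 / 2 * 1 * chirp_angle' t)"
        unfolding s'_def minus_minus using th' by (intro mult_left_mono mult_right_mono) (auto simp: chirp_rate_def)
      also have "\<dots> = \<delta>\<^sup>2 * exp (- (pi * m) - pi / 2) * chirp_angle' t"
        by (simp add: chirp_rate_def)
      also have "\<dots> \<le> \<delta>\<^sup>2 * exp (- chirp_angle t / 2) * chirp_angle' t"
        using th(2)[OF t(2)] th' by (intro mult_left_mono mult_right_mono) (auto simp: field_simps)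
      finally show ?thesis by (simp add: chirp_ampl_squared)
    qed
  qed
  have "\<Theta> b - \<Theta> a \<ge> chirp_rate m / 15 * ln (s a / s b) - 1"
    by (rule resonance.angle_growth[OF res])
  moreover have "chirp_rate m / 15 * ln (s a / s b) \<ge> chirp_rate m / 15 * ln (1 / D)"
  proof -
    have "s a = \<xi>" "s b = D" using b by (simp_all add: s_def freq_a)
    moreover have "1 / D \<le> \<xi> / D" using \<xi> D by (intro divide_right_mono) auto
    ultimately show ?thesis
      using D \<xi> by (intro mult_left_mono) (auto simp: chirp_rate_def)
  qed
  ultimately have "Im (logv (of_real \<xi>) b) - Im (logv (of_real \<xi>) a) \<ge> chirp_rate m / 15 * ln (1 / D) - 1 - pi / 2"
    using close[OF b(1)] by linarith
  then show ?thesis unfolding D_def using ad b by (intro exI[of _ a] exI[of _ b] conjI) auto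
qed

text \<open>The rate decays like \<open>exp (- pi * m)\<close>, while
  \<open>ln (1 / chirp_gap m)\<close> grows like \<open>exp (2 * pi * m) / 2\<close>. The gain of
  sweep \<open>m\<close> is thus of order \<open>\<delta>^2 * exp (pi * m)\<close>, which diverges
  however small \<open>\<delta>\<close> is.\<close>

lemma chirp_unbounded:
  assumes \<xi>: "\<xi> \<in> {1..2}"
  shows "\<exists>x\<ge>0. \<bar>Im (logv (of_real \<xi>) x)\<bar> > M"
proof -
  have gap: "chirp_gap m = 8 * \<delta> * exp (- ((exp (2 * pi * m) - 1) / 2) - 3 / 2 * pi * m)" for m
    by (simp add: chirp_gap_def chirp_ampl_def) (simp add: chirp_time_def)
  have lng: "ln (1 / chirp_gap m) = - ln (8 * \<delta>) + (exp (2 * pi * m) - 1) / 2 + 3 / 2 * pi * m" for m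
    using \<delta> by (simp add: gap ln_div ln_mult)
  have "filterlim (\<lambda>m::nat. 2 / 3 * \<delta>\<^sup>2 * exp (- (pi * m) - pi / 2) / 15 *
     (- ln (8 * \<delta>) + (exp (2 * pi * m) - 1) / 2 + 3 / 2 * pi * m) - 1 - pi / 2) at_top at_top"
    using \<delta> by real_asymp
  then have "filterlim (\<lambda>m. chirp_rate m / 15 * ln (1 / chirp_gap m) - 1 - pi / 2) at_top at_top"
    by (simp add: lng chirp_rate_def)
  then have ev1: "\<forall>\<^sub>F m in at_top. chirp_rate m / 15 * ln (1 / chirp_gap m) - 1 - pi / 2 > 2 * \<bar>M\<bar>"
    by (simp add: filterlim_at_top_dense)
  have "((\<lambda>m::nat. 8 * \<delta> * exp (- ((exp (2 * pi * m) - 1) / 2) - 3 / 2 * pi * m)) \<longlongrightarrow> 0) at_top"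
    by real_asymp
  then have "\<forall>\<^sub>F m in at_top. chirp_gap m < 1"
    unfolding gap[symmetric] by (rule order_tendstoD) simp
  with ev1 have "\<forall>\<^sub>F m in at_top. chirp_gap m < 1 \<and> chirp_rate m / 15 * ln (1 / chirp_gap m) - 1 - pi / 2 > 2 * \<bar>M\<bar>"
    by eventually_elim auto
  then obtain m where m: "chirp_gap m < 1" "chirp_rate m / 15 * ln (1 / chirp_gap m) - 1 - pi / 2 > 2 * \<bar>M\<bar>"
    by (metis (mono_tags, lifting) eventually_happens trivial_limit_at_top_linorder)
  then obtain x y where "x \<ge> 0" "y \<ge> 0" "Im (logv (of_real \<xi>) y) - Im (logv (of_real \<xi>) x) > 2 * \<bar>M\<bar>"
    using sweep_growth[OF \<xi> m(1)] by (meson less_le_trans)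
  \<comment> \<open>Two phases that differ by more than \<open>2 * \<bar>M\<bar>\<close> cannot both
    have modulus at most \<open>\<bar>M\<bar>\<close>.\<close>
  then have "\<bar>Im (logv (of_real \<xi>) y)\<bar> > M \<or> \<bar>Im (logv (of_real \<xi>) x)\<bar> > M" by linarith
  with \<open>x \<ge> 0\<close> \<open>y \<ge> 0\<close> show ?thesis by blast
qed

end

section \<open>Failure of convergence and of the maximal bounds\<close>

lemma divergent_coefficient_exists:
  assumes "\<delta> > 0"
  obtains A where "A \<in> L2_half_line" "L2_half_line_norm A \<le> \<delta>"
    "\<And>\<xi>. \<xi> \<in> {1..2} \<Longrightarrow> \<not> (\<exists>l. ((\<lambda>x. krein_A x (of_real \<xi>) A) \<longlongrightarrow> l) at_top)"
    "\<And>\<xi>. \<xi> \<in> {1..2} \<Longrightarrow> krein_maximal \<xi> A = \<infinity>" "\<And>\<xi>. \<xi> \<in> {1..2} \<Longrightarrow> krein_maximal_w \<xi> A = \<infinity>"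
    "\<And>t. {\<xi>. krein_maximal_w \<xi> A \<ge> ereal t} \<in> sets lebesgue"
proof -
  \<comment> \<open>The norm of a chirp is \<open>sqrt 2\<close> times its amplitude parameter, so
    half of \<open>\<delta>\<close> keeps it below \<open>\<delta>\<close>.\<close>
  have pos: "\<delta> / 2 > 0" using assms by simp
  obtain A' u v where kc: "krein_C1 (chirp (\<delta> / 2)) A' u v"
    by (rule krein_C1_chirp) blast
  interpret krein_C1 "chirp (\<delta> / 2)" A' u v by (rule kc)
  note unb = chirp_unbounded[OF pos kc]
  have "sqrt 2 \<le> (2::real)" by (rule real_le_lsqrt) auto
  then have "sqrt 2 * (\<delta> / 2) \<le> 2 * (\<delta> / 2)"
    using pos by (intro mult_right_mono) auto
  then have "L2_half_line_norm (chirp (\<delta> / 2)) \<le> \<delta>"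
    using chirp_L2(2)[OF less_imp_le[OF pos]] by linarith
  then show ?thesis
    using chirp_L2(1)[of "\<delta> / 2"] assms krein_A_not_convergent[OF unb] krein_maximal_infinite[OF unb] krein_maximal_w_measurable
    by (intro that[of "chirp (\<delta> / 2)"]) auto
qed

text \<open>The level sets contain \<open>[1, 2]\<close> at every threshold, so their measure is at
  least 1, while the bound \<open>N / t\<close> tends to 0. The choice \<open>t = 2 * N + 1\<close>
  makes it less than 1/2 and is positive even if \<open>N = 0\<close>.\<close>

lemma not_weak_type_bound:
  assumes "A \<in> L2_half_line" "L2_half_line_norm A \<le> \<delta>" "\<And>\<xi>. \<xi> \<in> {1..2} \<Longrightarrow> M \<xi> A = \<infinity>"
    and meas: "\<And>t. {\<xi>. M \<xi> A \<ge> ereal t} \<in> sets lebesgue"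
  shows "\<not> (\<exists>K\<ge>0. weak_type_bound M \<delta> K)"
proof
  assume "\<exists>K\<ge>0. weak_type_bound M \<delta> K"
  then obtain K where K: "K \<ge> 0" "weak_type_bound M \<delta> K" by blast
  define N where "N = K * L2_half_line_norm A"
  have N: "N \<ge> 0" using K by (simp add: N_def L2_half_line_norm_def)
  define t where "t = 2 * N + 1"
  have t: "t > 0" using N by (simp add: t_def)
  have "emeasure lebesgue {1..2::real} \<le> emeasure lebesgue {\<xi>. M \<xi> A \<ge> ereal t}"
    using assms(3) by (intro emeasure_mono meas) auto
  also have "\<dots> \<le> ennreal (N / t)"
    using K(2) assms(1,2) t unfolding weak_type_bound_def N_def by blast
  also have "\<dots> < 1"
    using N by (simp add: t_def ennreal_less_one_iff)
  finally show False by simp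
qed

lemma not_null_if_superset:
  assumes "{1..2::real} \<subseteq> S" shows "S \<notin> null_sets lebesgue"
proof
  assume "S \<in> null_sets lebesgue"
  then have "{1..2::real} \<in> null_sets lebesgue"
    by (rule null_sets_subset) (use assms in auto)
  then show False by (simp add: null_sets_def)
qed

lemma not_AE_finite:
  fixes M :: "real \<Rightarrow> ereal"
  assumes "\<And>\<xi>. \<xi> \<in> {1..2} \<Longrightarrow> M \<xi> = \<infinity>"
  shows "\<not> (AE \<xi> in lebesgue. M \<xi> < \<infinity>)"
proof
  assume "AE \<xi> in lebesgue. M \<xi> < \<infinity>"
  then obtain N where N: "{\<xi> \<in> space lebesgue. \<not> M \<xi> < \<infinity>} \<subseteq> N" "N \<in> null_sets lebesgue"
    by (rule AE_E) (blast intro: null_setsI)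
  have "{1..2} \<subseteq> {\<xi> \<in> space lebesgue. \<not> M \<xi> < \<infinity>}" using assms by auto
  with N show False using not_null_if_superset[of N] by blast
qed

theorem theorem1p1:
  shows
    "(\<exists>A \<in> L2_half_line.
        {\<xi>::real. \<not> ((\<exists>l. ((\<lambda>x. krein_A x (of_real \<xi>) A) \<longlongrightarrow> l) at_top) \<and>
                   (\<exists>l. ((\<lambda>x. krein_B x (of_real \<xi>) A) \<longlongrightarrow> l) at_top))}
          \<notin> null_sets lebesgue) \<and>
     \<not> (\<forall>A \<in> L2_half_line. AE \<xi> in lebesgue. krein_maximal \<xi> A < \<infinity>) \<and>
     \<not> (\<forall>A \<in> L2_half_line. AE \<xi> in lebesgue. krein_maximal_w \<xi> A < \<infinity>) \<and>
     (\<forall>\<delta>\<^sub>0>0. \<not> (\<exists>K\<ge>0. weak_type_bound krein_maximal \<delta>\<^sub>0 K)) \<and>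
     (\<forall>\<delta>\<^sub>0>0. \<not> (\<exists>K\<ge>0. weak_type_bound krein_maximal_w \<delta>\<^sub>0 K))"
proof -
  obtain A where A: "A \<in> L2_half_line"
    "\<And>\<xi>. \<xi> \<in> {1..2} \<Longrightarrow> \<not> (\<exists>l. ((\<lambda>x. krein_A x (of_real \<xi>) A) \<longlongrightarrow> l) at_top)"
    "\<And>\<xi>. \<xi> \<in> {1..2} \<Longrightarrow> krein_maximal \<xi> A = \<infinity>" "\<And>\<xi>. \<xi> \<in> {1..2} \<Longrightarrow> krein_maximal_w \<xi> A = \<infinity>"
    by (rule divergent_coefficient_exists[of 1]) auto
  \<comment> \<open>Divergence of \<open>krein_A\<close> alone already puts every point of
    \<open>[1, 2]\<close> into this set.\<close>
  have "{\<xi>::real. \<not> ((\<exists>l. ((\<lambda>x. krein_A x (of_real \<xi>) A) \<longlongrightarrow> l) at_top) \<and>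
                   (\<exists>l. ((\<lambda>x. krein_B x (of_real \<xi>) A) \<longlongrightarrow> l) at_top))} \<notin> null_sets lebesgue"
    by (rule not_null_if_superset) (use A(2) in auto)
  moreover have "\<not> (AE \<xi> in lebesgue. krein_maximal \<xi> A < \<infinity>)"
    by (rule not_AE_finite[OF A(3)])
  moreover have "\<not> (AE \<xi> in lebesgue. krein_maximal_w \<xi> A < \<infinity>)"
    by (rule not_AE_finite[OF A(4)])
  moreover have "\<not> (\<exists>K\<ge>0. weak_type_bound krein_maximal \<delta> K) \<and> \<not> (\<exists>K\<ge>0. weak_type_bound krein_maximal_w \<delta> K)"
    if pos: "\<delta> > 0" for \<delta>
  proof -
    obtain A where "A \<in> L2_half_line" "L2_half_line_norm A \<le> \<delta>"
      "\<And>\<xi>. \<xi> \<in> {1..2} \<Longrightarrow> krein_maximal \<xi> A = \<infinity>" "\<And>\<xi>. \<xi> \<in> {1..2} \<Longrightarrow> krein_maximal_w \<xi> A = \<infinity>"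
      "\<And>t. {\<xi>. krein_maximal_w \<xi> A \<ge> ereal t} \<in> sets lebesgue"
      by (rule divergent_coefficient_exists[OF pos]) auto
    then show ?thesis
      using krein_maximal_measurable by (intro conjI not_weak_type_bound[of A]) auto
  qed
  ultimately show ?thesis using A(1) by blast
qed

end
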